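(* Let $M$ be a complete Riemannian manifold of dimension $m$ with heat kernel $p^M_t$. Let $x\in M$ and $t>0$, and suppose that $p^M_t(x,y_1)=p^M_t(x,y_2)$ whenever $d(x,y_1)=d(x,y_2)$. Let $y\in M$ with $d_0:=d(x,y)>0$. For $\epsilon>0$ and $N\in\mathbb{N}$, let $k$ be the number of those among $N$ independent Brownian motion sample paths on $M$ starting from $x$ whose position at time $t$ lies in $S_x(d_0,\epsilon)=\{z\in M: |d(x,z)-d_0|<\epsilon\}$, and set $$\hat{p}^M_t(x,y)=\frac{1}{\operatorname{Vol}(S_x(d_0,\epsilon))}\,\frac{k}{N}.$$ Then $\hat{p}^M_t(x,y)$ is an asymptotically unbiased and consistent estimator of $p^M_t(x,y)$, in the sense that $$\lim_{\epsilon\to 0}\operatorname{E}\big(\hat{p}^M_t(x,y)\big)=p^M_t(x,y),\qquad \lim_{\frac{1}{N\epsilon^m}\to 0}\operatorname{Var}\big(\hat{p}^M_t(x,y)\big)=0.$$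
   Context: $d$ denotes the geodesic distance on $M$ and $\operatorname{Vol}$ the Riemannian volume. The heat kernel $p^M_t(x,y)$ is the smooth function on $M\times M\times(0,\infty)$ satisfying $\partial_t p^M_t=\tfrac12\Delta p^M_t$ ($\Delta$ the Laplace–Beltrami operator) with $p^M_t(x,\cdot)\to\delta_x$ in the distributional sense as $t\to0$. Brownian motion $B_x$ on $M$ started at $x$ is the process whose transition density is the heat kernel: $\mathbb{P}\{B_x(t)\in D\}=\int_D p^M_t(x,z)\,dz$ for every Borel set $D\subseteq M$, the integral being with respect to the Riemannian volume. The second limit means: for all choices of pairs $(\epsilon,N)$ along which $1/(N\epsilon^m)\to 0$, the variance tends to $0$. *)

theory Defs
  imports "HOL-Probability.Probability"
begin

section \<open>Smooth functions between normed spaces\<close>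

fun Ck_on :: "nat \<Rightarrow> 'b::real_normed_vector set \<Rightarrow> ('b \<Rightarrow> 'c::real_normed_vector) \<Rightarrow> bool" where
  "Ck_on 0 U f \<longleftrightarrow> continuous_on U f"
| "Ck_on (Suc k) U f \<longleftrightarrow> (\<forall>u\<in>U. f differentiable (at u)) \<and>
     (\<forall>v. Ck_on k U (\<lambda>u. frechet_derivative f (at u) v))"

text \<open>Only used for open \<open>U\<close> in finite-dimensional spaces, where testing the derivative on
  each fixed vector \<open>v\<close> amounts to continuity of all iterated partial derivatives.\<close>

definition smooth_on :: "'b::real_normed_vector set \<Rightarrow> ('b \<Rightarrow> 'c::real_normed_vector) \<Rightarrow> bool" where
  "smooth_on U f \<longleftrightarrow> (\<forall>k. Ck_on k U f)"


section \<open>Smooth manifolds\<close>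

text \<open>The manifold is the whole type \<open>'a\<close>, its topology being that of the type class; its
  dimension is \<open>CARD('m)\<close>. A chart is a pair of a domain and a coordinate map, whose values
  outside the domain are irrelevant.\<close>

type_synonym ('a, 'm) chart = "'a set \<times> ('a \<Rightarrow> real ^ 'm)"

definition chart_dom :: "('a, 'm) chart \<Rightarrow> 'a set" where
  "chart_dom c = fst c"

definition chart_map :: "('a, 'm) chart \<Rightarrow> 'a \<Rightarrow> real ^ 'm" where
  "chart_map c = snd c"

definition chart_ran :: "('a, 'm) chart \<Rightarrow> (real ^ 'm) set" where
  "chart_ran c = chart_map c ` chart_dom c"

definition chart_inv :: "('a, 'm) chart \<Rightarrow> real ^ 'm \<Rightarrow> 'a" where
  "chart_inv c = inv_into (chart_dom c) (chart_map c)"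

definition transition :: "('a, 'm) chart \<Rightarrow> ('a, 'm) chart \<Rightarrow> real ^ 'm \<Rightarrow> real ^ 'm" where
  "transition c c' = chart_map c' \<circ> chart_inv c"

definition overlap :: "('a, 'm) chart \<Rightarrow> ('a, 'm) chart \<Rightarrow> (real ^ 'm) set" where
  "overlap c c' = chart_map c ` (chart_dom c \<inter> chart_dom c')"

definition smooth_atlas :: "('a::topological_space, 'm::finite) chart set \<Rightarrow> bool" where
  "smooth_atlas A \<longleftrightarrow>
     (\<forall>c\<in>A. open (chart_dom c) \<and> open (chart_ran c) \<and>
        homeomorphism (chart_dom c) (chart_ran c) (chart_map c) (chart_inv c)) \<and>
     (\<Union>c\<in>A. chart_dom c) = UNIV \<and>
     (\<forall>c\<in>A. \<forall>c'\<in>A. smooth_on (overlap c c') (transition c c'))"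

text \<open>Used for notions that do not depend on the choice of the chart around the point.\<close>

definition chart_at :: "('a, 'm) chart set \<Rightarrow> 'a \<Rightarrow> ('a, 'm) chart" where
  "chart_at A q = (SOME c. c \<in> A \<and> q \<in> chart_dom c)"

definition smooth_fun :: "('a, 'm::finite) chart set \<Rightarrow> ('a \<Rightarrow> real) \<Rightarrow> bool" where
  "smooth_fun A f \<longleftrightarrow> (\<forall>c\<in>A. smooth_on (chart_ran c) (f \<circ> chart_inv c))"


section \<open>Riemannian metrics\<close>

text \<open>A metric assigns to a chart \<open>c\<close> and a coordinate point \<open>u\<close> the matrix
  \<open>(g\<^sub>i\<^sub>j(u))\<close> of the metric tensor in these coordinates; the last condition is the
  transformation law of a covariant 2-tensor.\<close>

type_synonym ('a, 'm) metric_tensor = "('a, 'm) chart \<Rightarrow> real ^ 'm \<Rightarrow> real ^ 'm ^ 'm"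

definition riemannian_metric ::
    "('a, 'm::finite) chart set \<Rightarrow> ('a, 'm) metric_tensor \<Rightarrow> bool" where
  "riemannian_metric A g \<longleftrightarrow>
     (\<forall>c\<in>A. \<forall>i j. smooth_on (chart_ran c) (\<lambda>u. g c u $ i $ j)) \<and>
     (\<forall>c\<in>A. \<forall>u\<in>chart_ran c. transpose (g c u) = g c u \<and>
        (\<forall>v. v \<noteq> 0 \<longrightarrow> v \<bullet> (g c u *v v) > 0)) \<and>
     (\<forall>c\<in>A. \<forall>c'\<in>A. \<forall>u\<in>overlap c c'.
        let J = matrix (frechet_derivative (transition c c') (at u))
        in g c u = transpose J ** g c' (transition c c' u) ** J)"


section \<open>Geodesic distance and completeness\<close>

definition C1_curve_on ::
    "('a::topological_space, 'm::finite) chart set \<Rightarrow> real set \<Rightarrow> (real \<Rightarrow> 'a) \<Rightarrow> bool" where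
  "C1_curve_on A I \<gamma> \<longleftrightarrow> continuous_on I \<gamma> \<and>
     (\<forall>c\<in>A. \<exists>v. continuous_on {s\<in>I. \<gamma> s \<in> chart_dom c} v \<and>
        (\<forall>s\<in>I. \<gamma> s \<in> chart_dom c \<longrightarrow>
           ((chart_map c \<circ> \<gamma>) has_vector_derivative v s) (at s within I)))"

text \<open>\<open>Q\<close> is the set of break points; the curve is \<open>C\<^sup>1\<close> up to the end points on each interval
  between two consecutive break points.\<close>

definition piecewise_C1_curve ::
    "('a::topological_space, 'm::finite) chart set \<Rightarrow> (real \<Rightarrow> 'a) \<Rightarrow> bool" where
  "piecewise_C1_curve A \<gamma> \<longleftrightarrow>
     (\<exists>Q. finite Q \<and> {0, 1} \<subseteq> Q \<and> Q \<subseteq> {0..1} \<and>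
        (\<forall>a\<in>Q. \<forall>b\<in>Q. a < b \<and> Q \<inter> {a<..<b} = {} \<longrightarrow> C1_curve_on A {a..b} \<gamma>))"

definition speed ::
    "('a, 'm::finite) chart set \<Rightarrow> ('a, 'm) metric_tensor \<Rightarrow> (real \<Rightarrow> 'a) \<Rightarrow> real \<Rightarrow> real" where
  "speed A g \<gamma> s =
     (let c = chart_at A (\<gamma> s);
          v = vector_derivative (chart_map c \<circ> \<gamma>) (at s)
      in sqrt (v \<bullet> (g c (chart_map c (\<gamma> s)) *v v)))"

definition curve_length ::
    "('a, 'm::finite) chart set \<Rightarrow> ('a, 'm) metric_tensor \<Rightarrow> (real \<Rightarrow> 'a) \<Rightarrow> real" where
  "curve_length A g \<gamma> = integral {0..1} (speed A g \<gamma>)"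

definition geodesic_dist ::
    "('a::topological_space, 'm::finite) chart set \<Rightarrow> ('a, 'm) metric_tensor \<Rightarrow> 'a \<Rightarrow> 'a \<Rightarrow> real" where
  "geodesic_dist A g q r =
     Inf {curve_length A g \<gamma> | \<gamma>. piecewise_C1_curve A \<gamma> \<and> \<gamma> 0 = q \<and> \<gamma> 1 = r}"

text \<open>Connectedness makes the distance finite. Metric completeness is equivalent to geodesic
  completeness by the Hopf-Rinow theorem.\<close>

definition complete_riemannian_manifold ::
    "('a::{t2_space, second_countable_topology}, 'm::finite) chart set \<Rightarrow>
     ('a, 'm) metric_tensor \<Rightarrow> bool" where
  "complete_riemannian_manifold A g \<longleftrightarrow>
     smooth_atlas A \<and> riemannian_metric A g \<and> connected (UNIV :: 'a set) \<and>
     Metric_space.mcomplete UNIV (geodesic_dist A g)"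


section \<open>Riemannian volume, Laplace--Beltrami operator, heat kernel\<close>

text \<open>By second countability and the change of variables formula there is exactly one
  such Borel measure.\<close>

definition riemannian_volume ::
    "('a::topological_space, 'm::finite) chart set \<Rightarrow> ('a, 'm) metric_tensor \<Rightarrow> 'a measure \<Rightarrow> bool" where
  "riemannian_volume A g vol \<longleftrightarrow> sets vol = sets borel \<and>
     (\<forall>c\<in>A. \<forall>D\<in>sets borel. D \<subseteq> chart_dom c \<longrightarrow>
        emeasure vol D =
          (\<integral>\<^sup>+u\<in>chart_map c ` D. ennreal (sqrt (det (g c u))) \<partial>lborel))"

definition partial_deriv :: "'m::finite \<Rightarrow> (real ^ 'm \<Rightarrow> real) \<Rightarrow> real ^ 'm \<Rightarrow> real" where
  "partial_deriv i F u = frechet_derivative F (at u) (axis i 1)"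

definition laplace_beltrami ::
    "('a, 'm::finite) chart set \<Rightarrow> ('a, 'm) metric_tensor \<Rightarrow> ('a \<Rightarrow> real) \<Rightarrow> 'a \<Rightarrow> real" where
  "laplace_beltrami A g f q =
     (let c = chart_at A q;
          F = f \<circ> chart_inv c;
          w = (\<lambda>u. sqrt (det (g c u)));
          u0 = chart_map c q
      in (\<Sum>i\<in>UNIV. partial_deriv i
            (\<lambda>u. w u * (\<Sum>j\<in>UNIV. matrix_inv (g c u) $ i $ j * partial_deriv j F u)) u0) / w u0)"

definition test_fun :: "('a::topological_space, 'm::finite) chart set \<Rightarrow> ('a \<Rightarrow> real) \<Rightarrow> bool" where
  "test_fun A f \<longleftrightarrow> smooth_fun A f \<and> (\<exists>K. compact K \<and> (\<forall>q. q \<notin> K \<longrightarrow> f q = 0))"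

text \<open>\<open>p t x y\<close> stands for \<open>p\<^sub>t(x,y)\<close>; the Laplacian acts on \<open>y\<close>.\<close>

definition heat_kernel ::
    "('a::topological_space, 'm::finite) chart set \<Rightarrow> ('a, 'm) metric_tensor \<Rightarrow> 'a measure \<Rightarrow>
     (real \<Rightarrow> 'a \<Rightarrow> 'a \<Rightarrow> real) \<Rightarrow> bool" where
  "heat_kernel A g vol p \<longleftrightarrow>
     (\<forall>c\<in>A. \<forall>c'\<in>A. smooth_on (chart_ran c \<times> chart_ran c' \<times> {0<..})
        (\<lambda>(u, v, t). p t (chart_inv c u) (chart_inv c' v))) \<and>
     (\<forall>t>0. \<forall>x y. ((\<lambda>s. p s x y) has_real_derivative
        (1/2) * laplace_beltrami A g (p t x) y) (at t)) \<and>
     (\<forall>x f. test_fun A f \<longrightarrow>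
        ((\<lambda>t. \<integral>y. p t x y * f y \<partial>vol) \<longlongrightarrow> f x) (at_right 0))"


section \<open>Brownian motion\<close>

text \<open>\<open>markov_fdd vol p z s [(t\<^sub>1, D\<^sub>1), \<dots>, (t\<^sub>n, D\<^sub>n)]\<close> is the iterated integral
  \<open>\<integral>\<^bsub>D\<^sub>1\<^esub> p\<^bsub>t\<^sub>1-s\<^esub>(z,z\<^sub>1) \<dots> \<integral>\<^bsub>D\<^sub>n\<^esub> p\<^bsub>t\<^sub>n-t\<^sub>n\<^sub>-\<^sub>1\<^esub>(z\<^sub>n\<^sub>-\<^sub>1,z\<^sub>n) dz\<^sub>n \<dots> dz\<^sub>1\<close>.\<close>

fun markov_fdd :: "'a measure \<Rightarrow> (real \<Rightarrow> 'a \<Rightarrow> 'a \<Rightarrow> real) \<Rightarrow> 'a \<Rightarrow> real \<Rightarrow>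
    (real \<times> 'a set) list \<Rightarrow> ennreal" where
  "markov_fdd vol p z s [] = 1"
| "markov_fdd vol p z s ((t, D) # l) =
     (\<integral>\<^sup>+w\<in>D. (ennreal (p (t - s) z w) * markov_fdd vol p w t l) \<partial>vol)"

text \<open>A process on the manifold with transition density \<open>p\<close>, started at \<open>x\<close>. The case of lists of
  length one is \<open>\<P>{X(t) \<in> D} = \<integral>\<^sub>D p\<^sub>t(x,z) dz\<close>. A transition density is
  nonnegative, which has to be stated since \<open>ennreal\<close> truncates negative values. Path
  continuity is not demanded.\<close>

definition brownian_motion ::
    "'a::topological_space measure \<Rightarrow> (real \<Rightarrow> 'a \<Rightarrow> 'a \<Rightarrow> real) \<Rightarrow> 'a \<Rightarrow>
     'w measure \<Rightarrow> (real \<Rightarrow> 'w \<Rightarrow> 'a) \<Rightarrow> bool" where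
  "brownian_motion vol p x P X \<longleftrightarrow>
     prob_space P \<and>
     (\<forall>s\<ge>0. X s \<in> measurable P borel) \<and>
     (AE \<omega> in P. X 0 \<omega> = x) \<and>
     (\<forall>s>0. \<forall>z w. 0 \<le> p s z w) \<and>
     (\<forall>l. sorted_wrt (<) (0 # map fst l) \<and> snd ` set l \<subseteq> sets borel \<longrightarrow>
        emeasure P {\<omega>\<in>space P. \<forall>(s, D)\<in>set l. X s \<omega> \<in> D} = markov_fdd vol p x 0 l)"

text \<open>Independence of whole paths: the paths are random elements of the product space
  indexed by times in \<open>[0,\<infinity>)\<close>.\<close>

definition independent_brownian_motions ::
    "'a::topological_space measure \<Rightarrow> (real \<Rightarrow> 'a \<Rightarrow> 'a \<Rightarrow> real) \<Rightarrow> 'a \<Rightarrow>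
     'w measure \<Rightarrow> nat \<Rightarrow> (nat \<Rightarrow> real \<Rightarrow> 'w \<Rightarrow> 'a) \<Rightarrow> bool" where
  "independent_brownian_motions vol p x P N B \<longleftrightarrow>
     (\<forall>i<N. brownian_motion vol p x P (B i)) \<and>
     prob_space.indep_vars P (\<lambda>_. Pi\<^sub>M {0..} (\<lambda>_. borel))
       (\<lambda>i \<omega>. \<lambda>s\<in>{0..}. B i s \<omega>) {..<N}"


section \<open>The estimator\<close>

definition shell ::
    "('a::topological_space, 'm::finite) chart set \<Rightarrow> ('a, 'm) metric_tensor \<Rightarrow>
     'a \<Rightarrow> real \<Rightarrow> real \<Rightarrow> 'a set" where
  "shell A g x d0 \<epsilon> = {z. \<bar>geodesic_dist A g x z - d0\<bar> < \<epsilon>}"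

definition heat_kernel_estimator ::
    "('a::topological_space, 'm::finite) chart set \<Rightarrow> ('a, 'm) metric_tensor \<Rightarrow> 'a measure \<Rightarrow>
     (nat \<Rightarrow> real \<Rightarrow> 'w \<Rightarrow> 'a) \<Rightarrow> real \<Rightarrow> 'a \<Rightarrow> 'a \<Rightarrow> real \<Rightarrow> nat \<Rightarrow> 'w \<Rightarrow> real" where
  "heat_kernel_estimator A g vol B t x y \<epsilon> N \<omega> =
     (let S = shell A g x (geodesic_dist A g x y) \<epsilon>;
          k = card {i. i < N \<and> B i t \<omega> \<in> S}
      in 1 / measure vol S * (real k / real N))"

end

theory Submission
  imports Defs
begin

text \<open>
  Write \<open>d = d(x,\<cdot>)\<close>, \<open>f = p\<^sub>t(x,\<cdot>)\<close>, \<open>S\<close> for the shell of width \<open>\<epsilon>\<close> around the level set of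
  \<open>d\<close> through \<open>y\<close>, \<open>V\<close> for its volume and \<open>q = \<integral>\<^sub>S f\<close> for the probability that one path
  hits it. The count \<open>k\<close> is a sum of \<open>N\<close> independent Bernoulli variables of parameter \<open>q\<close>, so
  the estimator has mean \<open>q/V\<close> and variance \<open>q(1-q)/(N V\<^sup>2)\<close>
  (\<open>empirical_frequency_moments\<close>). Everything else is about how \<open>q\<close> and \<open>V\<close> depend on \<open>\<epsilon>\<close>.

  The mean \<open>q/V\<close> is the average of \<open>f\<close> over \<open>S\<close>, so it tends to \<open>f(y)\<close> as soon as \<open>f\<close> is close
  to \<open>f(y)\<close> uniformly on thin shells. By the symmetry hypothesis \<open>f\<close> is a function of \<open>d\<close>, and
  what has to be seen is that it is a continuous function of \<open>d\<close>. Join \<open>y\<close> to a point at a larger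
  and to a point at a smaller distance from \<open>x\<close>, where there are such points, by compact
  connected sets; on their union \<open>d\<close> takes every value near \<open>d(y)\<close> that it takes at all, so
  every point of a thin shell can be replaced by a point of this compact set without changing \<open>d\<close>
  or \<open>f\<close>. There the claim is the usual compactness argument (\<open>uniform_closeness_near_level_set\<close>). An infinite \<open>V\<close> does no harm:
  the estimator is then \<open>0\<close>, and since \<open>q \<le> 1\<close> the value \<open>f(y)\<close> cannot exceed the oscillation
  of \<open>f\<close> on the shell (\<open>average_of_density_close\<close>).

  For the variance the widths are only constrained by \<open>1/(N \<epsilon>\<^sup>m) \<rightarrow> 0\<close>, so they may be small,
  moderate or large. For every \<open>\<eta> > 0\<close> there is a constant \<open>C\<close> with
  \<open>Var \<le> C/(N \<epsilon>\<^sup>m) + \<eta>\<close> in all three regimes: for small \<open>\<epsilon>\<close> because \<open>q/V\<close> is bounded and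
  \<open>V \<ge> c \<epsilon>\<^sup>m\<close> (\<open>shell_volume_lower_bound\<close>), for \<open>\<epsilon>\<close> in a bounded range away from \<open>0\<close> because
  \<open>V\<close> is bounded below and \<open>\<epsilon>\<^sup>m\<close> above, and for large \<open>\<epsilon>\<close> because the shells exhaust the
  manifold, so that \<open>q\<close> tends to \<open>1\<close>.

  The geometric input is that \<open>d\<close> is Lipschitz in the coordinates of a small chart ball
  (\<open>geodesic_dist_locally_Lipschitz\<close>): a curve from \<open>x\<close> to a point of the ball can be prolonged by
  a coordinate segment, whose length is at most a constant times the coordinate distance. This
  yields the continuity of \<open>d\<close>, and it shows that the shell contains a coordinate ball of radius
  proportional to \<open>\<epsilon>\<close>, whence the lower bound on \<open>V\<close>.
\<close>

section \<open>Preliminaries on matrices and smooth maps\<close>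

text \<open>The determinant has no zero on the segment from the identity matrix to \<open>M\<close>, since all matrices
  on it are positive definite.\<close>

lemma det_pos_if_pos_definite:
  fixes M :: "real ^ 'm ^ 'm"
  assumes pos: "\<And>v. v \<noteq> 0 \<Longrightarrow> v \<bullet> (M *v v) > 0"
  shows "det M > 0"
proof (rule ccontr)
  assume "\<not> det M > 0"
  define N where "N s = (1 - s) *\<^sub>R mat 1 + s *\<^sub>R M" for s :: real
  have "continuous_on {0..1} (\<lambda>s. det (N s))"
    unfolding det_def N_def
    by (intro continuous_intros continuous_on_prod)
  moreover have "det (N 0) = 1" "det (N 1) = det M" by (simp_all add: N_def)
  ultimately obtain s where s: "0 \<le> s" "s \<le> 1" "det (N s) = 0"
    using IVT2'[of "\<lambda>s. det (N s)" 1 0 0] \<open>\<not> det M > 0\<close> by auto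
  then have "\<not> invertible (N s)" by (simp add: invertible_det_nz)
  then obtain v where v: "N s *v v = 0" "v \<noteq> 0"
    by (auto simp: invertible_left_inverse matrix_left_invertible_ker)
  have "v \<bullet> (N s *v v) = (1 - s) * (v \<bullet> v) + s * (v \<bullet> (M *v v))"
    by (simp add: N_def matrix_vector_mult_add_rdistrib scaleR_matrix_vector_assoc[symmetric] inner_add_right)
  moreover have "v \<bullet> v > 0" "v \<bullet> (M *v v) > 0" using v pos by auto
  moreover have "(1 - s) * (v \<bullet> v) + s * (v \<bullet> (M *v v)) > 0"
  proof (cases "s = 0")
    case True then show ?thesis using v by simp
  next
    case False
    then have "s * (v \<bullet> (M *v v)) > 0" using s pos v by simp
    moreover have "(1 - s) * (v \<bullet> v) \<ge> 0" using s by simp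
    ultimately show ?thesis by linarith
  qed
  ultimately show False using v(1) by simp
qed

lemma smooth_on_imp_differentiable:
  "smooth_on U f \<Longrightarrow> u \<in> U \<Longrightarrow> f differentiable (at u)"
  unfolding smooth_on_def by (metis Ck_on.simps(2))

lemma smooth_on_imp_continuous: "smooth_on U f \<Longrightarrow> continuous_on U f"
  unfolding smooth_on_def by (metis Ck_on.simps(1))

lemma smooth_on_imp_continuous_derivative:
  "smooth_on U f \<Longrightarrow> continuous_on U (\<lambda>u. frechet_derivative f (at u) v)"
  unfolding smooth_on_def by (metis Ck_on.simps)

section \<open>Piecewise smooth curves\<close>

lemma C1_curve_on_affine:
  assumes "C1_curve_on A {k * a + l..k * b + l} \<gamma>" "k > 0"
  shows "C1_curve_on A {a..b} (\<lambda>s. \<gamma> (k * s + l))"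
proof -
  have img: "(\<lambda>s. k * s + l) ` {a..b} = {k * a + l..k * b + l}" if "a \<le> b"
    using that assms(2) by (auto simp: image_affinity_atLeastAtMost)
  show ?thesis
  proof (cases "a \<le> b")
    case False
    then show ?thesis by (auto simp: C1_curve_on_def)
  next
    case True
    note img = img[OF True]
    show ?thesis
      unfolding C1_curve_on_def
    proof (intro conjI ballI)
      have "continuous_on {k * a + l..k * b + l} \<gamma>"
        using assms(1) by (simp add: C1_curve_on_def)
      then show "continuous_on {a..b} (\<lambda>s. \<gamma> (k * s + l))"
        by (intro continuous_on_compose2[where g=\<gamma> and f="\<lambda>s. k * s + l"] continuous_intros)
          (auto simp: img)
    next
      fix c assume "c \<in> A"
      then obtain v where v: "continuous_on {s\<in>{k * a + l..k * b + l}. \<gamma> s \<in> chart_dom c} v"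
        "\<And>s. s \<in> {k * a + l..k * b + l} \<Longrightarrow> \<gamma> s \<in> chart_dom c \<Longrightarrow>
          ((chart_map c \<circ> \<gamma>) has_vector_derivative v s) (at s within {k * a + l..k * b + l})"
        using assms(1) unfolding C1_curve_on_def by meson
      have "continuous_on {s\<in>{a..b}. \<gamma> (k * s + l) \<in> chart_dom c} (\<lambda>s. k *\<^sub>R v (k * s + l))"
        using v(1) assms(2)
        by (intro continuous_intros continuous_on_compose2[where g=v and f="\<lambda>s. k * s + l"]) auto
      moreover have "((chart_map c \<circ> (\<lambda>s. \<gamma> (k * s + l))) has_vector_derivative k *\<^sub>R v (k * s + l))
          (at s within {a..b})" if "s \<in> {a..b}" "\<gamma> (k * s + l) \<in> chart_dom c" for s
      proof -
        have "((\<lambda>s. k * s + l) has_vector_derivative k) (at s within {a..b})"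
          by (auto intro!: derivative_eq_intros simp: has_real_derivative_iff_has_vector_derivative[symmetric])
        moreover have "((chart_map c \<circ> \<gamma>) has_vector_derivative v (k * s + l))
            (at (k * s + l) within (\<lambda>s. k * s + l) ` {a..b})"
          unfolding img by (rule v(2)) (use that assms(2) in auto)
        ultimately show ?thesis
          using vector_diff_chain_within by (fastforce simp: o_def)
      qed
      ultimately show "\<exists>v. continuous_on {s \<in> {a..b}. \<gamma> (k * s + l) \<in> chart_dom c} v \<and>
        (\<forall>s\<in>{a..b}. \<gamma> (k * s + l) \<in> chart_dom c \<longrightarrow>
          ((chart_map c \<circ> (\<lambda>s. \<gamma> (k * s + l))) has_vector_derivative v s) (at s within {a..b}))"
        by blast
    qed
  qed
qed

lemma C1_curve_on_cong:
  assumes "C1_curve_on A I \<gamma>" "\<And>s. s \<in> I \<Longrightarrow> \<gamma> s = \<eta> s"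
  shows "C1_curve_on A I \<eta>"
  unfolding C1_curve_on_def
proof (intro conjI ballI)
  show "continuous_on I \<eta>"
    using assms continuous_on_cong unfolding C1_curve_on_def by metis
next
  fix c assume "c \<in> A"
  then obtain v where v: "continuous_on {s\<in>I. \<gamma> s \<in> chart_dom c} v"
    "\<And>s. s \<in> I \<Longrightarrow> \<gamma> s \<in> chart_dom c \<Longrightarrow>
       ((chart_map c \<circ> \<gamma>) has_vector_derivative v s) (at s within I)"
    using assms(1) unfolding C1_curve_on_def by meson
  have "((chart_map c \<circ> \<eta>) has_vector_derivative v s) (at s within I)"
    if "s \<in> I" "\<eta> s \<in> chart_dom c" for s
    by (rule has_vector_derivative_transform[OF _ _ v(2)]) (use that assms(2) in auto)
  moreover have "{s\<in>I. \<gamma> s \<in> chart_dom c} = {s\<in>I. \<eta> s \<in> chart_dom c}"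
    using assms(2) by auto
  ultimately show "\<exists>v. continuous_on {s\<in>I. \<eta> s \<in> chart_dom c} v \<and>
      (\<forall>s\<in>I. \<eta> s \<in> chart_dom c \<longrightarrow>
        ((chart_map c \<circ> \<eta>) has_vector_derivative v s) (at s within I))"
    using v(1) by auto
qed

text \<open>The break points of the joined curve are those of the two halves, rescaled. The junction \<open>1/2\<close>
  is one of them, so an interval between consecutive break points lies on one side of it.\<close>

lemma piecewise_C1_curve_join:
  assumes "piecewise_C1_curve A \<gamma>1" "piecewise_C1_curve A \<gamma>2" "\<gamma>1 1 = \<gamma>2 0"
  shows "piecewise_C1_curve A (\<gamma>1 +++ \<gamma>2)"
proof -
  obtain Q1 where Q1: "finite Q1" "{0,1} \<subseteq> Q1" "Q1 \<subseteq> {0..1}"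
    "\<And>a b. a \<in> Q1 \<Longrightarrow> b \<in> Q1 \<Longrightarrow> a < b \<Longrightarrow> Q1 \<inter> {a<..<b} = {} \<Longrightarrow> C1_curve_on A {a..b} \<gamma>1"
    using assms(1) unfolding piecewise_C1_curve_def by metis
  obtain Q2 where Q2: "finite Q2" "{0,1} \<subseteq> Q2" "Q2 \<subseteq> {0..1}"
    "\<And>a b. a \<in> Q2 \<Longrightarrow> b \<in> Q2 \<Longrightarrow> a < b \<Longrightarrow> Q2 \<inter> {a<..<b} = {} \<Longrightarrow> C1_curve_on A {a..b} \<gamma>2"
    using assms(2) unfolding piecewise_C1_curve_def by metis
  define Q where "Q = {s. s \<in> {0..1/2} \<and> 2 * s \<in> Q1} \<union> {s. s \<in> {1/2..1} \<and> 2 * s - 1 \<in> Q2}"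
  have "Q \<subseteq> (\<lambda>q. q / 2) ` Q1 \<union> (\<lambda>q. (q + 1) / 2) ` Q2"
  proof
    fix s assume "s \<in> Q"
    then consider "2 * s \<in> Q1" | "2 * s - 1 \<in> Q2" by (auto simp: Q_def)
    then show "s \<in> (\<lambda>q. q / 2) ` Q1 \<union> (\<lambda>q. (q + 1) / 2) ` Q2"
    proof cases
      case 1
      then show ?thesis by (intro UnI1 image_eqI) auto
    next
      case 2
      then show ?thesis by (intro UnI2 image_eqI) auto
    qed
  qed
  then have fin: "finite Q"
    using Q1(1) Q2(1) by (meson finite_UnI finite_imageI finite_subset)
  have Q: "{0,1} \<subseteq> Q" "Q \<subseteq> {0..1}" "1/2 \<in> Q"
    using Q1(2) Q2(2) by (auto simp: Q_def)
  have low: "2 * s \<in> Q1" if "s \<in> Q" "s \<le> 1/2" for s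
  proof (cases "s = 1/2")
    case True
    then have "2 * s = 1" by simp
    then show ?thesis using Q1(2) by (metis insert_subset)
  next
    case False
    then show ?thesis using that by (simp add: Q_def)
  qed
  have high: "2 * s - 1 \<in> Q2" if "s \<in> Q" "s \<ge> 1/2" for s
  proof (cases "s = 1/2")
    case True
    then have "2 * s - 1 = 0" by simp
    then show ?thesis using Q2(2) by (metis insert_subset)
  next
    case False
    then show ?thesis using that by (simp add: Q_def)
  qed
  have "C1_curve_on A {a..b} (\<gamma>1 +++ \<gamma>2)"
    if ab: "a \<in> Q" "b \<in> Q" "a < b" "Q \<inter> {a<..<b} = {}" for a b
  proof (cases "b \<le> 1/2")
    case True
    have "Q1 \<inter> {2*a<..<2*b} = {}"
    proof (rule ccontr)
      assume "Q1 \<inter> {2*a<..<2*b} \<noteq> {}"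
      then obtain q where q: "q \<in> Q1" "2*a < q" "q < 2*b" by auto
      then have "q / 2 \<in> Q \<inter> {a<..<b}" using True Q1(3) by (auto simp: Q_def)
      then show False using ab(4) by auto
    qed
    moreover have "2 * a \<in> Q1" "2 * b \<in> Q1"
      using low ab True by simp_all
    ultimately have "C1_curve_on A {2*a..2*b} \<gamma>1"
      using Q1(4) ab(3) by auto
    from C1_curve_on_affine[of _ 2 _ 0, simplified, OF this]
    show ?thesis
      by (rule C1_curve_on_cong) (use True in \<open>auto simp: joinpaths_def\<close>)
  next
    case False
    then have a: "a \<ge> 1/2" using Q(3) ab(4) by force
    have "Q2 \<inter> {2*a-1<..<2*b-1} = {}"
    proof (rule ccontr)
      assume "Q2 \<inter> {2*a-1<..<2*b-1} \<noteq> {}"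
      then obtain q where q: "q \<in> Q2" "2*a-1 < q" "q < 2*b-1" by auto
      define s where "s = (q + 1) / 2"
      then have "2 * s - 1 = q" by (simp add: field_simps)
      then have "2 * s - 1 \<in> Q2" "s \<in> {1/2..1}" "s \<in> {a<..<b}"
        using q a Q2(3) by auto
      then have "s \<in> Q \<inter> {a<..<b}" by (simp add: Q_def)
      then show False using ab(4) by auto
    qed
    moreover have "2 * a - 1 \<in> Q2" "2 * b - 1 \<in> Q2"
      using high ab a by simp_all
    ultimately have "C1_curve_on A {2*a-1..2*b-1} \<gamma>2"
      using Q2(4) ab(3) by auto
    from C1_curve_on_affine[of _ 2 _ "-1", simplified, OF this]
    moreover have "\<gamma>2 (2 * s - 1) = (\<gamma>1 +++ \<gamma>2) s" if "s \<in> {a..b}" for s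
    proof (cases "s = 1/2")
      case True
      then have "2 * s = 1" by simp
      then show ?thesis using assms(3) by (simp add: joinpaths_def)
    next
      case False
      then show ?thesis using that a by (simp add: joinpaths_def)
    qed
    ultimately show ?thesis
      by (rule C1_curve_on_cong)
  qed
  then show ?thesis
    unfolding piecewise_C1_curve_def using fin Q(1,2) by (intro exI[of _ Q]) simp
qed

lemma piecewise_C1_curve_differentiable:
  assumes "piecewise_C1_curve A \<gamma>"
  obtains Q where "finite Q" "{0, 1} \<subseteq> Q"
    "\<And>s c. s \<in> {0..1} - Q \<Longrightarrow> c \<in> A \<Longrightarrow> \<gamma> s \<in> chart_dom c \<Longrightarrow>
       (chart_map c \<circ> \<gamma>) differentiable (at s)"
proof -
  obtain Q where Q: "finite Q" "{0,1} \<subseteq> Q" "Q \<subseteq> {0..1}"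
    "\<And>a b. a \<in> Q \<Longrightarrow> b \<in> Q \<Longrightarrow> a < b \<Longrightarrow> Q \<inter> {a<..<b} = {} \<Longrightarrow> C1_curve_on A {a..b} \<gamma>"
    using assms(1) unfolding piecewise_C1_curve_def by metis
  have "(chart_map c \<circ> \<gamma>) differentiable (at s)"
    if s: "s \<in> {0..1} - Q" and c: "c \<in> A" "\<gamma> s \<in> chart_dom c" for s c
  proof -
    define a where "a = Max {q\<in>Q. q < s}"
    define b where "b = Min {q\<in>Q. s < q}"
    have ne: "{q\<in>Q. q < s} \<noteq> {}" "{q\<in>Q. s < q} \<noteq> {}"
    proof -
      have "s \<noteq> 0" "s \<noteq> 1" using s Q(2) by auto
      then have "0 < s" "s < 1" using s by auto
      then show "{q\<in>Q. q < s} \<noteq> {}" "{q\<in>Q. s < q} \<noteq> {}" using Q(2) by blast+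
    qed
    have "finite {q\<in>Q. q < s}" "finite {q\<in>Q. s < q}" using Q(1) by simp_all
    then have "a \<in> {q\<in>Q. q < s}" "b \<in> {q\<in>Q. s < q}"
      unfolding a_def b_def using Max_in[OF _ ne(1)] Min_in[OF _ ne(2)] by blast+
    then have a: "a \<in> Q" "a < s" and b: "b \<in> Q" "s < b" by simp_all
    have "Q \<inter> {a<..<b} = {}"
    proof (rule ccontr)
      assume "Q \<inter> {a<..<b} \<noteq> {}"
      then obtain q where q: "q \<in> Q" "a < q" "q < b" by auto
      consider "q < s" | "s < q" using q s by force
      then show False
      proof cases
        case 1
        then have "q \<le> a" unfolding a_def using q Q(1) by (intro Max_ge) auto
        then show False using q by simp
      next
        case 2
        then have "b \<le> q" unfolding b_def using q Q(1) by (intro Min_le) auto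
        then show False using q by simp
      qed
    qed
    then have "C1_curve_on A {a..b} \<gamma>" using Q(4) a b by auto
    then obtain v where "((chart_map c \<circ> \<gamma>) has_vector_derivative v s) (at s within {a..b})"
      using c a b unfolding C1_curve_on_def by (meson atLeastAtMost_iff less_imp_le)
    then have "((chart_map c \<circ> \<gamma>) has_vector_derivative v s) (at s)"
      using a b by (simp add: at_within_Icc_at)
    then show ?thesis
      using differentiableI_vector by blast
  qed
  then show thesis using that Q(1,2) by blast
qed

section \<open>Charts and curve length\<close>

definition chart_segment :: "('a, 'm::finite) chart \<Rightarrow> real ^ 'm \<Rightarrow> real ^ 'm \<Rightarrow> real \<Rightarrow> 'a" where
  "chart_segment c u v s = chart_inv c (u + s *\<^sub>R (v - u))"

locale riemannian_atlas =
  fixes A :: "('a::{t2_space, second_countable_topology}, 'm::finite) chart set"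
    and g :: "('a, 'm) metric_tensor"
  assumes atlas: "smooth_atlas A" and metric: "riemannian_metric A g"
begin

lemma
  assumes "c \<in> A"
  shows open_chart_dom: "open (chart_dom c)"
    and open_chart_ran: "open (chart_ran c)"
    and chart_homeomorphism: "homeomorphism (chart_dom c) (chart_ran c) (chart_map c) (chart_inv c)"
  using atlas assms unfolding smooth_atlas_def by auto

lemma chart_inv_chart_map: "c \<in> A \<Longrightarrow> q \<in> chart_dom c \<Longrightarrow> chart_inv c (chart_map c q) = q"
  and chart_map_chart_inv: "c \<in> A \<Longrightarrow> u \<in> chart_ran c \<Longrightarrow> chart_map c (chart_inv c u) = u"
  and chart_map_in_ran: "c \<in> A \<Longrightarrow> q \<in> chart_dom c \<Longrightarrow> chart_map c q \<in> chart_ran c"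
  and chart_inv_in_dom: "c \<in> A \<Longrightarrow> u \<in> chart_ran c \<Longrightarrow> chart_inv c u \<in> chart_dom c"
  using chart_homeomorphism[of c] unfolding homeomorphism_def by blast+

lemma continuous_on_chart_inv: "c \<in> A \<Longrightarrow> continuous_on (chart_ran c) (chart_inv c)"
  and continuous_on_chart_map: "c \<in> A \<Longrightarrow> continuous_on (chart_dom c) (chart_map c)"
  using chart_homeomorphism by (auto simp: homeomorphism_def)

lemma chart_at_props: "chart_at A q \<in> A" "q \<in> chart_dom (chart_at A q)"
proof -
  have "\<exists>c. c \<in> A \<and> q \<in> chart_dom c"
    using atlas unfolding smooth_atlas_def by blast
  from someI_ex[OF this] show "chart_at A q \<in> A" "q \<in> chart_dom (chart_at A q)"
    unfolding chart_at_def by auto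
qed

lemma overlapI: "c \<in> A \<Longrightarrow> u \<in> chart_ran c \<Longrightarrow> chart_inv c u \<in> chart_dom c' \<Longrightarrow> u \<in> overlap c c'"
  unfolding overlap_def
  by (metis IntI chart_inv_in_dom chart_map_chart_inv imageI)

lemma metric_nonneg: "c \<in> A \<Longrightarrow> u \<in> chart_ran c \<Longrightarrow> v \<bullet> (g c u *v v) \<ge> 0"
  using metric unfolding riemannian_metric_def by (cases "v = 0") (auto intro: less_imp_le)

lemma speed_nonneg: "speed A g \<gamma> s \<ge> 0"
  unfolding speed_def Let_def
  by (simp add: chart_at_props chart_map_in_ran metric_nonneg)

lemma curve_length_nonneg: "curve_length A g \<gamma> \<ge> 0"
  unfolding curve_length_def
  by (cases "speed A g \<gamma> integrable_on {0..1}")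
    (auto intro: integral_nonneg speed_nonneg simp: not_integrable_integral)

lemma speed_affine:
  assumes "k \<ge> 0" "open I" "s \<in> I" "\<And>r. r \<in> I \<Longrightarrow> \<eta> r = \<gamma> (k * r + l)"
    and "\<And>c. c \<in> A \<Longrightarrow> \<gamma> (k * s + l) \<in> chart_dom c \<Longrightarrow>
           (chart_map c \<circ> \<gamma>) differentiable (at (k * s + l))"
  shows "speed A g \<eta> s = k * speed A g \<gamma> (k * s + l)"
proof -
  define c where "c = chart_at A (\<gamma> (k * s + l))"
  define v where "v = vector_derivative (chart_map c \<circ> \<gamma>) (at (k * s + l))"
  have "((chart_map c \<circ> \<gamma>) has_vector_derivative v) (at (k * s + l))"
    unfolding v_def using assms(5) chart_at_props c_def vector_derivative_works by blast
  moreover have "((\<lambda>s. k * s + l) has_vector_derivative k) (at s)"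
    by (auto intro!: derivative_eq_intros simp: has_real_derivative_iff_has_vector_derivative[symmetric])
  ultimately have "((chart_map c \<circ> \<gamma> \<circ> (\<lambda>s. k * s + l)) has_vector_derivative k *\<^sub>R v) (at s)"
    using vector_diff_chain_at by blast
  then have "((chart_map c \<circ> \<eta>) has_vector_derivative k *\<^sub>R v) (at s)"
    by (rule has_vector_derivative_transform_within_open[OF _ assms(2,3)]) (simp add: assms(4))
  then have "vector_derivative (chart_map c \<circ> \<eta>) (at s) = k *\<^sub>R v"
    by (rule vector_derivative_at)
  moreover have "\<eta> s = \<gamma> (k * s + l)" using assms by auto
  ultimately show ?thesis
    using assms(1) unfolding speed_def Let_def
    by (simp add: c_def[symmetric] v_def[symmetric] matrix_vector_mult_scaleR real_sqrt_mult
        flip: mult.assoc)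
qed

text \<open>Substitution rule for the length of a reparametrised curve, phrased with
  \<open>has_integral\<close> so that integrability of the speed passes from \<open>\<eta>\<close> to \<open>\<gamma>\<close>. The break points of
  \<open>\<gamma>\<close> have to be left out, because \<open>vector_derivative\<close> takes an unspecified value at a corner.\<close>

lemma speed_has_integral_affine:
  assumes "piecewise_C1_curve A \<gamma>" "k > 0" "k * a + l = 0" "k * b + l = 1"
    and "\<And>s. s \<in> {a<..<b} \<Longrightarrow> \<eta> s = \<gamma> (k * s + l)"
    and "(speed A g \<eta> has_integral I) {a..b}"
  shows "(speed A g \<gamma> has_integral I) {0..1}"
proof -
  obtain Q where Q: "finite Q" "{0, 1} \<subseteq> Q"
    "\<And>s c. s \<in> {0..1} - Q \<Longrightarrow> c \<in> A \<Longrightarrow> \<gamma> s \<in> chart_dom c \<Longrightarrow>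
       (chart_map c \<circ> \<gamma>) differentiable (at s)"
    using piecewise_C1_curve_differentiable[OF assms(1)] by blast
  have a: "a = - l / k" and b: "b = (1 - l) / k"
    using assms(2,3,4) by (auto simp: field_simps)
  define Q' where "Q' = (\<lambda>q. (q - l) / k) ` Q"
  have "finite Q'" using Q(1) by (simp add: Q'_def)
  have eq: "k * speed A g \<gamma> (k * s + l) = speed A g \<eta> s" if s: "s \<in> {a..b} - Q'" for s
  proof -
    have nQ: "k * s + l \<notin> Q"
    proof
      assume "k * s + l \<in> Q"
      then have "(k * s + l - l) / k \<in> Q'" unfolding Q'_def by blast
      then show False using s assms(2) by auto
    qed
    then have "k * s + l \<noteq> 0" "k * s + l \<noteq> 1" using Q(2) by auto
    then have "s \<noteq> a" "s \<noteq> b" using assms(3,4) by auto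
    then have ss: "s \<in> {a<..<b}" using s by auto
    then have "k * s + l \<in> {0..1}" using assms(2) by (auto simp: a b field_simps)
    with nQ Q(3) have "\<And>c. c \<in> A \<Longrightarrow> \<gamma> (k * s + l) \<in> chart_dom c \<Longrightarrow>
           (chart_map c \<circ> \<gamma>) differentiable (at (k * s + l))" by blast
    from speed_affine[OF _ open_greaterThanLessThan ss assms(5) this] assms(2)
    show ?thesis by simp
  qed
  have "((\<lambda>s. k * speed A g \<gamma> (k * s + l)) has_integral I) {a..b}"
    by (rule has_integral_spike_finite[OF \<open>finite Q'\<close> eq assms(6)])
  then have "((\<lambda>s. k * speed A g \<gamma> (k * s + l)) has_integral ((k * I) /\<^sub>R k ^ DIM(real)))
       (cbox ((0 - l) /\<^sub>R k) ((1 - l) /\<^sub>R k))"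
    using assms(2) by (simp add: a b field_simps)
  then have "((\<lambda>s. k * speed A g \<gamma> s) has_integral (k * I)) (cbox 0 1)"
    using has_integral_affinity_iff[OF assms(2), of "\<lambda>s. k * speed A g \<gamma> s" l "k * I" 0 1] by simp
  then show ?thesis
    using has_integral_cmul_iff[of k "speed A g \<gamma>" I "{0..1}"] assms(2) by simp
qed

text \<open>Only an inequality, so that no integrability has to be established: if the speed of the joined
  curve is not integrable, its length is \<open>0\<close> by convention and the claim is trivial;
  otherwise the speeds of both parts are integrable as well.\<close>

lemma curve_length_join:
  assumes "piecewise_C1_curve A \<gamma>1" "piecewise_C1_curve A \<gamma>2"
  shows "curve_length A g (\<gamma>1 +++ \<gamma>2) \<le> curve_length A g \<gamma>1 + curve_length A g \<gamma>2"
proof (cases "speed A g (\<gamma>1 +++ \<gamma>2) integrable_on {0..1}")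
  case False
  then show ?thesis
    using curve_length_nonneg[of \<gamma>1] curve_length_nonneg[of \<gamma>2]
    by (simp add: curve_length_def not_integrable_integral)
next
  case True
  let ?f = "speed A g (\<gamma>1 +++ \<gamma>2)"
  have "?f integrable_on {0..1/2}" "?f integrable_on {1/2..1}"
    using True by (rule integrable_subinterval_real; simp)+
  then have i: "(?f has_integral integral {0..1/2} ?f) {0..1/2}"
    "(?f has_integral integral {1/2..1} ?f) {1/2..1}"
    by auto
  have "(speed A g \<gamma>1 has_integral integral {0..1/2} ?f) {0..1}"
    by (rule speed_has_integral_affine[OF assms(1) _ _ _ _ i(1), where k=2 and l=0])
      (auto simp: joinpaths_def)
  moreover have "(speed A g \<gamma>2 has_integral integral {1/2..1} ?f) {0..1}"
    by (rule speed_has_integral_affine[OF assms(2) _ _ _ _ i(2), where k=2 and l="-1"])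
      (auto simp: joinpaths_def)
  ultimately show ?thesis
    using Henstock_Kurzweil_Integration.integral_combine[OF _ _ True, of "1/2"] unfolding curve_length_def
    by (simp add: integral_unique)
qed

section \<open>Coordinate segments\<close>

lemma transition_smooth: "c \<in> A \<Longrightarrow> c' \<in> A \<Longrightarrow> smooth_on (overlap c c') (transition c c')"
  using atlas unfolding smooth_atlas_def by blast

lemma transition_has_derivative:
  "c \<in> A \<Longrightarrow> c' \<in> A \<Longrightarrow> u \<in> overlap c c' \<Longrightarrow>
    (transition c c' has_derivative frechet_derivative (transition c c') (at u)) (at u)"
  using smooth_on_imp_differentiable[OF transition_smooth] frechet_derivative_works by blast

lemma chart_segment_has_vector_derivative:
  assumes "c \<in> A" "c' \<in> A" "u + s *\<^sub>R (v - u) \<in> overlap c c'"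
  shows "((chart_map c' \<circ> chart_segment c u v) has_vector_derivative
    frechet_derivative (transition c c') (at (u + s *\<^sub>R (v - u))) (v - u)) (at s)"
proof -
  let ?L = "\<lambda>s. u + s *\<^sub>R (v - u)"
  have "(transition c c' has_derivative frechet_derivative (transition c c') (at (?L s))) (at (?L s))"
    using assms by (rule transition_has_derivative)
  moreover have "(?L has_vector_derivative (v - u)) (at s)"
    by (auto intro!: derivative_eq_intros)
  ultimately have "((transition c c' \<circ> ?L) has_vector_derivative
     frechet_derivative (transition c c') (at (?L s)) (v - u)) (at s)"
    by (rule vector_derivative_diff_chain_within[OF _ has_derivative_at_withinI, rotated])
  then show ?thesis
    by (simp add: transition_def chart_segment_def o_def)
qed

lemma chart_segment_C1:
  assumes c: "c \<in> A" and ran: "closed_segment u v \<subseteq> chart_ran c"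
  shows "C1_curve_on A {0..1} (chart_segment c u v)"
  unfolding C1_curve_on_def
proof (intro conjI ballI)
  let ?L = "\<lambda>s. u + s *\<^sub>R (v - u)"
  have L: "?L s \<in> chart_ran c" if "s \<in> {0..1}" for s
    using ran that by (force simp: closed_segment_def algebra_simps)
  show "continuous_on {0..1} (chart_segment c u v)"
    unfolding chart_segment_def
    by (intro continuous_on_compose2[OF continuous_on_chart_inv[OF c]] continuous_intros)
      (use L in auto)
  fix c' assume c': "c' \<in> A"
  let ?D = "\<lambda>p. frechet_derivative (transition c c') (at p) (v - u)"
  have ov: "?L s \<in> overlap c c'" if "s \<in> {0..1}" "chart_segment c u v s \<in> chart_dom c'" for s
    using overlapI[OF c L[OF that(1)]] that(2) by (simp add: chart_segment_def)
  have "continuous_on (overlap c c') ?D"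
    using c c' by (intro smooth_on_imp_continuous_derivative transition_smooth)
  then have "continuous_on {s \<in> {0..1}. chart_segment c u v s \<in> chart_dom c'} (\<lambda>s. ?D (?L s))"
    by (rule continuous_on_compose2) (use ov in \<open>auto intro!: continuous_intros\<close>)
  moreover have "((chart_map c' \<circ> chart_segment c u v) has_vector_derivative ?D (?L s))
      (at s within {0..1})" if "s \<in> {0..1}" "chart_segment c u v s \<in> chart_dom c'" for s
    by (rule has_vector_derivative_at_within,
        rule chart_segment_has_vector_derivative[OF c c' ov[OF that]])
  ultimately show "\<exists>w. continuous_on {s \<in> {0..1}. chart_segment c u v s \<in> chart_dom c'} w \<and>
     (\<forall>s\<in>{0..1}. chart_segment c u v s \<in> chart_dom c' \<longrightarrow>
       ((chart_map c' \<circ> chart_segment c u v) has_vector_derivative w s) (at s within {0..1}))"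
    by blast
qed

lemma chart_segment_piecewise_C1:
  assumes "c \<in> A" "closed_segment u v \<subseteq> chart_ran c"
  shows "piecewise_C1_curve A (chart_segment c u v)"
  unfolding piecewise_C1_curve_def
  using chart_segment_C1[OF assms] by (intro exI[of _ "{0,1}"]) auto

text \<open>The transformation law of the metric tensor, read as the invariance of
  \<open>g(w,w)\<close>. It is needed because the speed at each time is computed in a chart selected
  by choice, whereas a coordinate segment lives in one fixed chart.\<close>

lemma metric_change_of_chart:
  assumes "c \<in> A" "c' \<in> A" "u \<in> overlap c c'"
  defines "D \<equiv> frechet_derivative (transition c c') (at u)"
  shows "D w \<bullet> (g c' (transition c c' u) *v D w) = w \<bullet> (g c u *v w)"
proof -
  define J where "J = matrix D"
  have "linear D"
    unfolding D_def using transition_has_derivative[OF assms(1-3)] by (rule has_derivative_linear)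
  then have J: "J *v w = D w" by (simp add: J_def matrix_works)
  have "g c u = transpose J ** g c' (transition c c' u) ** J"
    using metric assms unfolding riemannian_metric_def J_def D_def Let_def by blast
  then have "w \<bullet> (g c u *v w) = w \<bullet> (transpose J *v (g c' (transition c c' u) *v (J *v w)))"
    by (simp add: matrix_vector_mul_assoc matrix_mul_assoc)
  also have "\<dots> = (J *v w) \<bullet> (g c' (transition c c' u) *v (J *v w))"
    by (metis dot_lmul_matrix vector_transpose_matrix inner_commute transpose_transpose)
  finally show ?thesis by (simp add: J)
qed

lemma speed_chart_segment:
  assumes c: "c \<in> A" and ran: "u + s *\<^sub>R (v - u) \<in> chart_ran c"
  shows "speed A g (chart_segment c u v) s =
    sqrt ((v - u) \<bullet> (g c (u + s *\<^sub>R (v - u)) *v (v - u)))"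
proof -
  define p where "p = u + s *\<^sub>R (v - u)"
  define c' where "c' = chart_at A (chart_segment c u v s)"
  have c': "c' \<in> A" and ov: "p \<in> overlap c c'"
    using chart_at_props overlapI[OF c ran] by (auto simp: c'_def p_def chart_segment_def)
  have "vector_derivative (chart_map c' \<circ> chart_segment c u v) (at s) =
      frechet_derivative (transition c c') (at p) (v - u)"
    unfolding p_def
    by (rule vector_derivative_at, rule chart_segment_has_vector_derivative[OF c c'])
      (use ov p_def in simp)
  moreover have "chart_map c' (chart_segment c u v s) = transition c c' p"
    by (simp add: transition_def chart_segment_def p_def)
  ultimately show ?thesis
    unfolding speed_def Let_def c'_def[symmetric]
    by (simp add: metric_change_of_chart[OF c c' ov] flip: p_def)
qed

lemma curve_length_chart_segment:
  assumes c: "c \<in> A" and ran: "closed_segment u v \<subseteq> chart_ran c" and "K \<ge> 0"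
    and K: "\<And>p w. p \<in> closed_segment u v \<Longrightarrow> w \<bullet> (g c p *v w) \<le> K\<^sup>2 * (norm w)\<^sup>2"
  shows "curve_length A g (chart_segment c u v) \<le> K * norm (v - u)"
proof (cases "speed A g (chart_segment c u v) integrable_on {0..1}")
  case False
  then show ?thesis
    using \<open>K \<ge> 0\<close> by (simp add: curve_length_def not_integrable_integral)
next
  case True
  have "speed A g (chart_segment c u v) s \<le> K * norm (v - u)" if "s \<in> {0..1}" for s
  proof -
    have p: "u + s *\<^sub>R (v - u) \<in> closed_segment u v"
      using that by (force simp: closed_segment_def algebra_simps)
    have "speed A g (chart_segment c u v) s =
        sqrt ((v - u) \<bullet> (g c (u + s *\<^sub>R (v - u)) *v (v - u)))"
      using p ran by (intro speed_chart_segment c) auto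
    also have "\<dots> \<le> sqrt ((K * norm (v - u))\<^sup>2)"
      using K[OF p, of "v - u"] by (simp add: power_mult_distrib)
    finally show ?thesis using \<open>K \<ge> 0\<close> by simp
  qed
  then have "integral {0..1} (speed A g (chart_segment c u v)) \<le>
      integral {0..1::real} (\<lambda>_. K * norm (v - u))"
    by (intro integral_le True) auto
  then show ?thesis by (simp add: curve_length_def)
qed

text \<open>The entries of the metric tensor are bounded on a compact coordinate ball. Together with
  \<open>curve_length_chart_segment\<close> this compares lengths of segments with coordinate distances.\<close>

lemma metric_locally_bounded:
  assumes "c \<in> A" "u0 \<in> chart_ran c"
  obtains r K where "r > 0" "K > 0" "ball u0 r \<subseteq> chart_ran c"
    "\<And>u w. u \<in> ball u0 r \<Longrightarrow> w \<bullet> (g c u *v w) \<le> K\<^sup>2 * (norm w)\<^sup>2"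
proof -
  obtain r where r: "r > 0" "cball u0 r \<subseteq> chart_ran c"
    using open_chart_ran[OF assms(1)] assms(2) open_contains_cball by blast
  have "continuous_on (cball u0 r) (\<lambda>u. (\<Sum>i\<in>UNIV. norm (g c u $ i)))"
  proof -
    have "continuous_on (chart_ran c) (\<lambda>u. g c u $ i $ j)" for i j
      using metric assms smooth_on_imp_continuous unfolding riemannian_metric_def by blast
    then have "continuous_on (cball u0 r) (\<lambda>u. \<chi> j. g c u $ i $ j)" for i
      using r(2) continuous_on_subset by (intro continuous_on_vec_lambda) blast
    then show ?thesis by (intro continuous_on_sum continuous_on_norm) simp
  qed
  then have "bounded ((\<lambda>u. (\<Sum>i\<in>UNIV. norm (g c u $ i))) ` cball u0 r)"
    using compact_continuous_image compact_imp_bounded compact_cball by blast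
  then obtain b where b: "b > 0" "\<And>u. u \<in> cball u0 r \<Longrightarrow> (\<Sum>i\<in>UNIV. norm (g c u $ i)) \<le> b"
    unfolding bounded_pos by force
  have "w \<bullet> (g c u *v w) \<le> (sqrt b)\<^sup>2 * (norm w)\<^sup>2" if "u \<in> ball u0 r" for u w
  proof -
    have "norm (g c u *v w) \<le> (\<Sum>i\<in>UNIV. \<bar>(g c u *v w) $ i\<bar>)"
      by (rule norm_le_l1_cart)
    also have "\<dots> \<le> (\<Sum>i\<in>UNIV. norm (g c u $ i) * norm w)"
      by (intro sum_mono) (simp add: matrix_vector_mul_component Cauchy_Schwarz_ineq2)
    also have "\<dots> \<le> b * norm w"
      unfolding sum_distrib_right[symmetric] using that b(2)[of u]
      by (intro mult_right_mono) auto
    finally have "norm w * norm (g c u *v w) \<le> norm w * (b * norm w)"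
      by (intro mult_left_mono) auto
    moreover have "w \<bullet> (g c u *v w) \<le> norm w * norm (g c u *v w)"
      by (rule norm_cauchy_schwarz)
    ultimately show ?thesis using b(1) by (simp add: power2_eq_square algebra_simps)
  qed
  then show thesis using that[of r "sqrt b"] r b(1) ball_subset_cball by fastforce
qed

section \<open>The distance function in coordinates\<close>

definition reachable :: "'a \<Rightarrow> 'a \<Rightarrow> bool" where
  "reachable q r \<longleftrightarrow> (\<exists>\<gamma>. piecewise_C1_curve A \<gamma> \<and> \<gamma> 0 = q \<and> \<gamma> 1 = r)"

text \<open>A convex coordinate neighbourhood on which the Riemannian norm is at most \<open>K\<close> times the
  Euclidean one.\<close>

definition chart_ball :: "('a, 'm) chart \<Rightarrow> real ^ 'm \<Rightarrow> real \<Rightarrow> real \<Rightarrow> bool" where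
  "chart_ball c u0 r K \<longleftrightarrow> c \<in> A \<and> r > 0 \<and> K > 0 \<and> ball u0 r \<subseteq> chart_ran c \<and>
     (\<forall>u\<in>ball u0 r. \<forall>w. w \<bullet> (g c u *v w) \<le> K\<^sup>2 * (norm w)\<^sup>2)"

lemma chart_ball_exists:
  obtains c r K where "q \<in> chart_dom c" "chart_ball c (chart_map c q) r K"
proof -
  have c: "chart_at A q \<in> A" "q \<in> chart_dom (chart_at A q)" by (rule chart_at_props)+
  from metric_locally_bounded[OF c(1) chart_map_in_ran[OF c]]
  obtain r K where "r > 0" "K > 0" "ball (chart_map (chart_at A q) q) r \<subseteq> chart_ran (chart_at A q)"
    "\<And>u w. u \<in> ball (chart_map (chart_at A q) q) r \<Longrightarrow>
       w \<bullet> (g (chart_at A q) u *v w) \<le> K\<^sup>2 * (norm w)\<^sup>2"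
    by blast
  then show thesis using that c unfolding chart_ball_def by blast
qed

lemma chart_ball_image:
  assumes "chart_ball c u0 r K" "s \<le> r"
  shows "open (chart_inv c ` ball u0 s)" "chart_inv c ` ball u0 s \<subseteq> chart_dom c"
    "chart_map c ` chart_inv c ` ball u0 s = ball u0 s"
proof -
  have c: "c \<in> A" and sub: "ball u0 s \<subseteq> chart_ran c"
    using assms unfolding chart_ball_def by (auto simp: subset_iff)
  show "chart_inv c ` ball u0 s \<subseteq> chart_dom c"
    using sub chart_inv_in_dom[OF c] by blast
  show "chart_map c ` chart_inv c ` ball u0 s = ball u0 s"
    using sub chart_map_chart_inv[OF c] by (force simp: image_image)
  have "openin (top_of_set (chart_dom c)) (chart_inv c ` ball u0 s)"
    using homeomorphism_imp_open_map[OF homeomorphism_symD[OF chart_homeomorphism[OF c]]] sub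
    by (simp add: openin_open_eq[OF open_chart_ran[OF c]])
  then show "open (chart_inv c ` ball u0 s)"
    using open_chart_dom[OF c] openin_open_trans by blast
qed

lemma geodesic_dist_le:
  assumes "piecewise_C1_curve A \<gamma>" "\<gamma> 0 = q" "\<gamma> 1 = r"
  shows "geodesic_dist A g q r \<le> curve_length A g \<gamma>"
  unfolding geodesic_dist_def
  by (rule cInf_lower) (use assms in \<open>auto intro!: bdd_belowI[of _ 0] curve_length_nonneg\<close>)

text \<open>Prolong curves from \<open>x\<close> to the first point by the coordinate segment between the two points.
  Reachability enters because the infimum that defines the distance is only meaningful
  over a nonempty set of curves.\<close>

lemma chart_ball_step:
  assumes "chart_ball c u0 r K" "u \<in> ball u0 r" "v \<in> ball u0 r" "reachable x (chart_inv c u)"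
  shows "reachable x (chart_inv c v)"
    and "geodesic_dist A g x (chart_inv c v) \<le> geodesic_dist A g x (chart_inv c u) + K * norm (v - u)"
proof -
  have c: "c \<in> A" "K \<ge> 0" and seg: "closed_segment u v \<subseteq> ball u0 r"
    and ran: "closed_segment u v \<subseteq> chart_ran c"
    using assms closed_segment_subset[of u "ball u0 r" v] unfolding chart_ball_def by auto
  let ?\<sigma> = "chart_segment c u v"
  have \<sigma>: "piecewise_C1_curve A ?\<sigma>" "?\<sigma> 0 = chart_inv c u" "?\<sigma> 1 = chart_inv c v"
    using chart_segment_piecewise_C1[OF c(1) ran] by (auto simp: chart_segment_def)
  have len: "curve_length A g ?\<sigma> \<le> K * norm (v - u)"
    using assms(1) seg by (intro curve_length_chart_segment c ran) (auto simp: chart_ball_def)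
  have join: "piecewise_C1_curve A (\<gamma> +++ ?\<sigma>)" "(\<gamma> +++ ?\<sigma>) 0 = x" "(\<gamma> +++ ?\<sigma>) 1 = chart_inv c v"
    if "piecewise_C1_curve A \<gamma>" "\<gamma> 0 = x" "\<gamma> 1 = chart_inv c u" for \<gamma>
    using that \<sigma> piecewise_C1_curve_join[OF that(1) \<sigma>(1)] by (auto simp: joinpaths_def)
  show "reachable x (chart_inv c v)"
    using assms(4) join unfolding reachable_def by blast
  have "geodesic_dist A g x (chart_inv c v) - K * norm (v - u) \<le> geodesic_dist A g x (chart_inv c u)"
    unfolding geodesic_dist_def[of A g x "chart_inv c u"]
  proof (rule cInf_greatest)
    show "{curve_length A g \<gamma> |\<gamma>. piecewise_C1_curve A \<gamma> \<and> \<gamma> 0 = x \<and> \<gamma> 1 = chart_inv c u} \<noteq> {}"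
      using assms(4) unfolding reachable_def by blast
  next
    fix L assume "L \<in> {curve_length A g \<gamma> |\<gamma>. piecewise_C1_curve A \<gamma> \<and> \<gamma> 0 = x \<and> \<gamma> 1 = chart_inv c u}"
    then obtain \<gamma> where \<gamma>: "piecewise_C1_curve A \<gamma>" "\<gamma> 0 = x" "\<gamma> 1 = chart_inv c u"
      "L = curve_length A g \<gamma>" by blast
    have "geodesic_dist A g x (chart_inv c v) \<le> curve_length A g (\<gamma> +++ ?\<sigma>)"
      by (rule geodesic_dist_le) (use join \<gamma> in auto)
    also have "\<dots> \<le> L + K * norm (v - u)"
      using curve_length_join[OF \<gamma>(1) \<sigma>(1)] len \<gamma>(4) by simp
    finally show "geodesic_dist A g x (chart_inv c v) - K * norm (v - u) \<le> L" by simp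
  qed
  then show "geodesic_dist A g x (chart_inv c v) \<le> geodesic_dist A g x (chart_inv c u) + K * norm (v - u)"
    by simp
qed

text \<open>A property that spreads inside coordinate balls holds on an open set with open complement, and a connected
  space has no such sets but itself and the empty one.\<close>

lemma chart_step_induct:
  assumes "connected (UNIV :: 'a set)" "P x"
    and step: "\<And>c u0 r K u v. chart_ball c u0 r K \<Longrightarrow> u \<in> ball u0 r \<Longrightarrow> v \<in> ball u0 r \<Longrightarrow>
       P (chart_inv c u) \<Longrightarrow> P (chart_inv c v)"
  shows "P z"
proof (rule connected_induction_simple[OF assms(1), of x z P])
  fix q :: 'a
  obtain c r K where c: "q \<in> chart_dom c" "chart_ball c (chart_map c q) r K"
    by (rule chart_ball_exists)
  let ?T = "chart_inv c ` ball (chart_map c q) r"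
  have cA: "c \<in> A" "r > 0" using c(2) by (simp_all add: chart_ball_def)
  have "q \<in> ?T"
    using chart_inv_chart_map[OF cA(1) c(1)] cA(2) by (metis centre_in_ball imageI)
  moreover have "openin (top_of_set UNIV) ?T"
    using chart_ball_image(1)[OF c(2) order_refl] by (simp only: openin_open_eq[OF open_UNIV] subset_UNIV simp_thms)
  moreover have "\<forall>z\<in>?T. \<forall>w\<in>?T. P z \<longrightarrow> P w"
    using step[OF c(2)] by blast
  ultimately show "\<exists>T. openin (top_of_set UNIV) T \<and> q \<in> T \<and> (\<forall>z\<in>T. \<forall>w\<in>T. P z \<longrightarrow> P w)"
    by blast
qed (use assms(2) in auto)

lemma reachable_all:
  assumes "connected (UNIV :: 'a set)"
  shows "reachable x z"
proof (rule chart_step_induct[OF assms])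
  obtain c where c: "c \<in> A" "x \<in> chart_dom c" using chart_at_props by blast
  define u where "u = chart_map c x"
  have "piecewise_C1_curve A (chart_segment c u u)"
    using c by (intro chart_segment_piecewise_C1) (auto simp: u_def chart_map_in_ran)
  then show "reachable x x"
    using c unfolding reachable_def
    by (intro exI[of _ "chart_segment c u u"]) (auto simp: chart_segment_def u_def chart_inv_chart_map)
qed (rule chart_ball_step)

text \<open>Small coordinate segments are attached one after the other. A union of compact connected sets
  through a common point is again of this kind, whereas paths would have to be reparametrised.\<close>

lemma compact_connected_joining:
  fixes x z :: 'a
  assumes "connected (UNIV :: 'a set)"
  shows "\<exists>K. compact K \<and> connected K \<and> x \<in> K \<and> z \<in> K"
proof (rule chart_step_induct[OF assms, where P="\<lambda>z. \<exists>K. compact K \<and> connected K \<and> x \<in> K \<and> z \<in> K"])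
  show "\<exists>K. compact K \<and> connected K \<and> x \<in> K \<and> x \<in> K" by (intro exI[of _ "{x}"]) auto
next
  fix c u0 r K u v
  assume ball: "chart_ball c u0 r K" "u \<in> ball u0 r" "v \<in> ball u0 r"
    and "\<exists>K. compact K \<and> connected K \<and> x \<in> K \<and> chart_inv c u \<in> K"
  then obtain C where C: "compact C" "connected C" "x \<in> C" "chart_inv c u \<in> C" by blast
  let ?S = "chart_inv c ` closed_segment u v"
  have c: "c \<in> A" and "closed_segment u v \<subseteq> chart_ran c"
    using ball closed_segment_subset[of u "ball u0 r" v] unfolding chart_ball_def by auto
  then have "continuous_on (closed_segment u v) (chart_inv c)"
    using continuous_on_chart_inv continuous_on_subset by blast
  then have S: "compact ?S" "connected ?S"
    using compact_continuous_image connected_continuous_image by (metis compact_segment connected_segment)+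
  have "connected (C \<union> ?S)"
    by (rule connected_Un) (use C S in auto)
  then show "\<exists>K. compact K \<and> connected K \<and> x \<in> K \<and> chart_inv c v \<in> K"
    using C S by (intro exI[of _ "C \<union> ?S"]) auto
qed

lemma geodesic_dist_locally_Lipschitz:
  assumes "connected (UNIV :: 'a set)" "chart_ball c u0 r K" "u \<in> ball u0 r" "v \<in> ball u0 r"
  shows "\<bar>geodesic_dist A g x (chart_inv c v) - geodesic_dist A g x (chart_inv c u)\<bar> \<le> K * norm (v - u)"
  using chart_ball_step(2)[OF assms(2-4) reachable_all[OF assms(1), of x]]
    chart_ball_step(2)[OF assms(2,4,3) reachable_all[OF assms(1), of x]]
  by (simp add: norm_minus_commute abs_le_iff)

lemma continuous_geodesic_dist:
  assumes "connected (UNIV :: 'a set)"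
  shows "continuous_on UNIV (geodesic_dist A g x)"
proof -
  have "isCont (geodesic_dist A g x) q" for q
  proof -
    obtain c r K where c: "q \<in> chart_dom c" "chart_ball c (chart_map c q) r K"
      by (rule chart_ball_exists)
    let ?u = "chart_map c q"
    let ?T = "chart_inv c ` ball ?u r"
    have cA: "c \<in> A" and "r > 0" "K > 0" "ball ?u r \<subseteq> chart_ran c"
      using c(2) by (auto simp: chart_ball_def)
    note T = chart_ball_image[OF c(2) order_refl]
    have "(chart_map c \<longlongrightarrow> ?u) (at q)"
      using continuous_on_chart_map[OF cA] open_chart_dom[OF cA] c(1)
      by (simp add: continuous_on_eq_continuous_at isCont_def)
    then have lim: "((\<lambda>z. K * norm (chart_map c z - ?u)) \<longlongrightarrow> 0) (at q)"
      by (auto intro!: tendsto_eq_intros)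
    have "q \<in> ?T"
      using chart_inv_chart_map[OF cA c(1)] \<open>r > 0\<close> by (metis centre_in_ball imageI)
    then have "eventually (\<lambda>z. z \<in> ?T) (at q)"
      using T(1) by (simp add: eventually_at_in_open eventually_at_topological) blast
    then have "eventually (\<lambda>z. \<bar>geodesic_dist A g x z - geodesic_dist A g x q\<bar> \<le>
        K * norm (chart_map c z - ?u)) (at q)"
    proof eventually_elim
      case (elim z)
      then obtain v where "v \<in> ball ?u r" "z = chart_inv c v" by blast
      then show ?case
        using geodesic_dist_locally_Lipschitz[OF assms c(2), of ?u v x] \<open>r > 0\<close>
          chart_inv_chart_map[OF cA c(1)] chart_map_chart_inv[OF cA] \<open>ball ?u r \<subseteq> chart_ran c\<close>
        by auto
    qed
    then have "((\<lambda>z. geodesic_dist A g x z - geodesic_dist A g x q) \<longlongrightarrow> 0) (at q)"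
      by (intro Lim_null_comparison[OF _ lim]) simp
    then show ?thesis by (simp add: isCont_def LIM_zero_iff)
  qed
  then show ?thesis by (simp add: continuous_on_eq_continuous_at)
qed

section \<open>Volume of the shells\<close>

lemma volume_density_bounded_below:
  assumes "c \<in> A" "u0 \<in> chart_ran c"
  obtains r b where "r > 0" "b > 0" "\<And>u. u \<in> ball u0 r \<Longrightarrow> sqrt (det (g c u)) \<ge> b"
proof -
  have "continuous_on (chart_ran c) (\<lambda>u. g c u $ i $ j)" for i j
    using metric assms smooth_on_imp_continuous unfolding riemannian_metric_def by blast
  then have "continuous_on (chart_ran c) (\<lambda>u. sqrt (det (g c u)))"
    unfolding det_def
    by (intro continuous_on_real_sqrt continuous_on_sum continuous_on_mult continuous_on_const
        continuous_on_prod)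
  then have lim: "((\<lambda>u. sqrt (det (g c u))) \<longlongrightarrow> sqrt (det (g c u0))) (at u0)"
    using open_chart_ran[OF assms(1)] assms(2)
    by (simp add: continuous_on_eq_continuous_at isCont_def)
  define b where "b = sqrt (det (g c u0)) / 2"
  have "det (g c u0) > 0"
    using metric assms unfolding riemannian_metric_def by (intro det_pos_if_pos_definite) blast
  then have b: "b > 0" "b < sqrt (det (g c u0))" by (auto simp: b_def)
  have "eventually (\<lambda>u. b < sqrt (det (g c u))) (at u0)"
    using order_tendstoD(1)[OF lim b(2)] .
  then obtain r where "r > 0" "\<And>u. u \<noteq> u0 \<Longrightarrow> dist u u0 < r \<Longrightarrow> b < sqrt (det (g c u))"
    unfolding eventually_at by blast
  then have "sqrt (det (g c u)) \<ge> b" if "u \<in> ball u0 r" for u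
    using b(2) that by (cases "u = u0") (auto simp: dist_commute less_imp_le)
  then show thesis using that \<open>r > 0\<close> b(1) by blast
qed

lemma open_shell:
  assumes "connected (UNIV :: 'a set)"
  shows "open (shell A g x d0 \<epsilon>)"
  unfolding shell_def
  by (intro open_Collect_less continuous_intros continuous_geodesic_dist[OF assms])

text \<open>The shell contains the coordinate ball of radius \<open>\<epsilon>/K\<close> around \<open>y\<close>, where \<open>K\<close> is a Lipschitz
  constant of the distance in these coordinates, and the volume density is bounded below there.
  The bound also covers shells of infinite volume, hence \<open>emeasure\<close>.\<close>

lemma shell_volume_lower_bound:
  assumes con: "connected (UNIV :: 'a set)" and vol: "riemannian_volume A g vol"
  obtains \<epsilon>0 c0 where "\<epsilon>0 > 0" "c0 > 0"
    "\<And>\<epsilon>. 0 < \<epsilon> \<Longrightarrow> \<epsilon> \<le> \<epsilon>0 \<Longrightarrow>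
       ennreal (c0 * \<epsilon> ^ CARD('m)) \<le> emeasure vol (shell A g x (geodesic_dist A g x y) \<epsilon>)"
proof -
  obtain c r K where c: "y \<in> chart_dom c" "chart_ball c (chart_map c y) r K"
    by (rule chart_ball_exists)
  define u0 where "u0 = chart_map c y"
  note cb = c(2)[folded u0_def]
  have cA: "c \<in> A" and rK: "r > 0" "K > 0" and sub: "ball u0 r \<subseteq> chart_ran c"
    using cb by (auto simp: chart_ball_def)
  have y: "chart_inv c u0 = y"
    using chart_inv_chart_map[OF cA c(1)] by (simp add: u0_def)
  have "u0 \<in> chart_ran c" using sub rK by auto
  from volume_density_bounded_below[OF cA this]
  obtain r' b where b: "r' > 0" "b > 0" "\<And>u. u \<in> ball u0 r' \<Longrightarrow> sqrt (det (g c u)) \<ge> b"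
    by blast
  let ?m = "CARD('m)"
  define c0 where "c0 = b * (unit_ball_vol (real ?m) / K ^ ?m)"
  show thesis
  proof (rule that[of "K * min r r'" c0])
    show "K * min r r' > 0" using rK b by simp
    show "c0 > 0" using rK b by (simp add: c0_def)
  next
    fix \<epsilon> assume \<epsilon>: "0 < \<epsilon>" "\<epsilon> \<le> K * min r r'"
    define \<rho> where "\<rho> = \<epsilon> / K"
    have "\<rho> \<le> min r r'"
      unfolding \<rho>_def pos_divide_le_eq[OF rK(2)] using \<epsilon>(2) by (simp only: mult.commute)
    then have \<rho>: "\<rho> > 0" "\<rho> \<le> r" "\<rho> \<le> r'" using \<epsilon> rK by (simp_all add: \<rho>_def)
    let ?D = "chart_inv c ` ball u0 \<rho>"
    let ?S = "shell A g x (geodesic_dist A g x y) \<epsilon>"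
    note D = chart_ball_image[OF cb \<rho>(2)]
    have "?D \<subseteq> ?S"
    proof
      fix z assume "z \<in> ?D"
      then obtain v where v: "v \<in> ball u0 \<rho>" "z = chart_inv c v" by blast
      have "\<bar>geodesic_dist A g x z - geodesic_dist A g x y\<bar> \<le> K * norm (v - u0)"
        using geodesic_dist_locally_Lipschitz[OF con cb, of u0 v x] v \<rho> rK by (simp add: y)
      also have "\<dots> < K * \<rho>"
        using v rK by (simp add: dist_norm norm_minus_commute)
      finally show "z \<in> ?S" using rK by (simp add: shell_def \<rho>_def)
    qed
    moreover have "sets vol = sets borel" using vol by (simp add: riemannian_volume_def)
    ultimately have le: "emeasure vol ?D \<le> emeasure vol ?S"
      using open_shell[OF con] by (intro emeasure_mono) auto
    have "c0 * \<epsilon> ^ ?m = b * (unit_ball_vol (real ?m) * \<rho> ^ ?m)"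
      by (simp add: c0_def \<rho>_def power_divide)
    also have "ennreal \<dots> = ennreal b * emeasure lborel (ball u0 \<rho>)"
      using \<rho>(1) b(2) by (simp add: emeasure_ball ennreal_mult')
    finally have "ennreal (c0 * \<epsilon> ^ ?m) = ennreal b * emeasure lborel (ball u0 \<rho>)" .
    also have "\<dots> = (\<integral>\<^sup>+u\<in>ball u0 \<rho>. ennreal b \<partial>lborel)"
      by (subst nn_integral_cmult_indicator) auto
    also have "\<dots> \<le> (\<integral>\<^sup>+u\<in>ball u0 \<rho>. ennreal (sqrt (det (g c u))) \<partial>lborel)"
      by (intro nn_integral_mono) (use b(3) \<rho>(3) in \<open>auto simp: indicator_def intro!: ennreal_leI\<close>)
    also have "\<dots> = emeasure vol ?D"
      using vol cA D unfolding riemannian_volume_def by simp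
    finally show "ennreal (c0 * \<epsilon> ^ ?m) \<le> emeasure vol ?S" using le by simp
  qed
qed

section \<open>Continuity of the heat kernel\<close>

lemma heat_kernel_continuous:
  assumes "heat_kernel A g vol p" "t > 0"
  shows "continuous_on UNIV (p t x)"
proof -
  have "isCont (p t x) q" for q
  proof -
    obtain c c' where c: "c \<in> A" "x \<in> chart_dom c" and c': "c' \<in> A" "q \<in> chart_dom c'"
      using chart_at_props by blast
    let ?F = "\<lambda>(u, v, t). p t (chart_inv c u) (chart_inv c' v)"
    have "continuous_on (chart_ran c \<times> chart_ran c' \<times> {0<..}) ?F"
      using assms(1) c(1) c'(1) smooth_on_imp_continuous unfolding heat_kernel_def by blast
    moreover have "continuous_on (chart_dom c') (\<lambda>z. (chart_map c x, chart_map c' z, t))"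
      using continuous_on_chart_map[OF c'(1)] by (intro continuous_intros)
    moreover have "(\<lambda>z. (chart_map c x, chart_map c' z, t)) ` chart_dom c' \<subseteq>
        chart_ran c \<times> chart_ran c' \<times> {0<..}"
      using chart_map_in_ran[OF c] chart_map_in_ran[OF c'(1)] assms(2) by blast
    ultimately have "continuous_on (chart_dom c') (\<lambda>z. ?F (chart_map c x, chart_map c' z, t))"
      by (rule continuous_on_compose2)
    then have "continuous_on (chart_dom c') (p t x)"
      by (rule continuous_on_eq) (simp add: chart_inv_chart_map[OF c] chart_inv_chart_map[OF c'(1)])
    then show ?thesis
      using open_chart_dom[OF c'(1)] c'(2) by (simp add: continuous_on_eq_continuous_at)
  qed
  then show ?thesis by (simp add: continuous_on_eq_continuous_at)
qed

end

section \<open>Functions that factor through a continuous function\<close>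

lemma values_above_attained_on_compact:
  fixes d :: "'a::topological_space \<Rightarrow> real"
  assumes d: "continuous_on UNIV d"
    and joined: "\<And>z. \<exists>K. compact K \<and> connected K \<and> y \<in> K \<and> z \<in> K"
  shows "\<exists>K \<delta>. compact K \<and> \<delta> > 0 \<and> (\<forall>z. d y \<le> d z \<and> d z < d y + \<delta> \<longrightarrow> d z \<in> d ` K)"
proof (cases "\<exists>z. d z > d y")
  case True
  then obtain z where z: "d z > d y" by blast
  obtain K where K: "compact K" "connected K" "y \<in> K" "z \<in> K" using joined by blast
  have "connected (d ` K)"
    using K d by (intro connected_continuous_image) (auto intro: continuous_on_subset)
  then have "{d y..d z} \<subseteq> d ` K"
    using K connected_contains_Icc by blast
  then show ?thesis
    using z K by (intro exI[of _ K] exI[of _ "d z - d y"]) force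
next
  case False
  then have "d z = d y" if "d y \<le> d z" for z
    using that by (meson antisym not_le)
  then show ?thesis by (intro exI[of _ "{y}"] exI[of _ 1]) simp
qed

text \<open>Values of \<open>d\<close> near \<open>d y\<close> are attained on a compact set, so it suffices to control \<open>f\<close>
  there. The part of that set where \<open>f\<close> is at least \<open>\<eta>\<close> away from \<open>f y\<close> has a compact image
  under \<open>d\<close>, which misses \<open>d y\<close> and hence a neighbourhood of it.\<close>

lemma uniform_closeness_near_level_set:
  fixes d f :: "'a::topological_space \<Rightarrow> real"
  assumes d: "continuous_on UNIV d" and f: "continuous_on UNIV f"
    and fact: "\<And>z w. d z = d w \<Longrightarrow> f z = f w"
    and joined: "\<And>z. \<exists>K. compact K \<and> connected K \<and> y \<in> K \<and> z \<in> K"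
    and "\<eta> > 0"
  obtains \<delta> where "\<delta> > 0" "\<And>z. \<bar>d z - d y\<bar> < \<delta> \<Longrightarrow> \<bar>f z - f y\<bar> < \<eta>"
proof -
  obtain K1 \<delta>1 where 1: "compact K1" "\<delta>1 > 0"
    "\<And>z. d y \<le> d z \<Longrightarrow> d z < d y + \<delta>1 \<Longrightarrow> d z \<in> d ` K1"
    using values_above_attained_on_compact[OF d joined] by metis
  have "continuous_on UNIV (\<lambda>z. - d z)" using d by (intro continuous_intros)
  from values_above_attained_on_compact[OF this joined]
  obtain K2 \<delta>2 where 2: "compact K2" "\<delta>2 > 0"
    "\<And>z. - d y \<le> - d z \<Longrightarrow> - d z < - d y + \<delta>2 \<Longrightarrow> - d z \<in> (\<lambda>z. - d z) ` K2" by metis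
  define C where "C = (K1 \<union> K2) \<inter> {z. \<bar>f z - f y\<bar> \<ge> \<eta>}"
  have "closed {z. \<bar>f z - f y\<bar> \<ge> \<eta>}"
    using f by (intro closed_Collect_le continuous_intros)
  then have "compact C"
    unfolding C_def using 1(1) 2(1) by (intro compact_Int_closed compact_Un)
  then have "closed (d ` C)"
    using d by (intro compact_imp_closed compact_continuous_image) (auto intro: continuous_on_subset)
  moreover have "d y \<notin> d ` C"
  proof
    assume "d y \<in> d ` C"
    then obtain z where z: "z \<in> C" "d y = d z" by blast
    then have "f y = f z" using fact by blast
    then show False using z \<open>\<eta> > 0\<close> by (simp add: C_def)
  qed
  ultimately obtain \<delta>3 where 3: "\<delta>3 > 0" "ball (d y) \<delta>3 \<subseteq> - d ` C"
    by (meson ComplI open_Compl open_contains_ball)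
  show thesis
  proof (rule that[of "min \<delta>1 (min \<delta>2 \<delta>3)"])
    show "min \<delta>1 (min \<delta>2 \<delta>3) > 0" using 1 2 3 by simp
  next
    fix z assume z: "\<bar>d z - d y\<bar> < min \<delta>1 (min \<delta>2 \<delta>3)"
    have "d z \<in> d ` (K1 \<union> K2)"
      using 1(3)[of z] 2(3)[of z] z by (cases "d y \<le> d z") (auto simp: image_iff)
    then obtain k where k: "k \<in> K1 \<union> K2" "d z = d k" by blast
    have "d z \<in> ball (d y) \<delta>3" using z by (simp add: dist_real_def abs_minus_commute)
    then have "k \<notin> C" using 3(2) k(2) by blast
    then show "\<bar>f z - f y\<bar> < \<eta>"
      using k fact[of z k] by (auto simp: C_def)
  qed
qed

section \<open>Moments of an empirical frequency\<close>

lemma (in prob_space) variance_sum_indep_vars: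
  fixes X :: "'i \<Rightarrow> 'a \<Rightarrow> real"
  assumes I: "finite I" and indep: "indep_vars (\<lambda>_. borel) X I"
    and int: "\<And>i. i \<in> I \<Longrightarrow> integrable M (X i)"
    and int2: "\<And>i. i \<in> I \<Longrightarrow> integrable M (\<lambda>\<omega>. (X i \<omega>)\<^sup>2)"
  shows "variance (\<lambda>\<omega>. \<Sum>i\<in>I. X i \<omega>) = (\<Sum>i\<in>I. variance (X i))"
proof -
  define Y where "Y i \<omega> = X i \<omega> - expectation (X i)" for i \<omega>
  have indepY: "indep_vars (\<lambda>_. borel) Y I"
    unfolding Y_def by (rule indep_vars_compose2[OF indep]) auto
  have intY: "integrable M (Y i)" and mean: "expectation (Y i) = 0" if "i \<in> I" for i
    using int[OF that] by (simp_all add: Y_def[abs_def] prob_space)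
  have cross: "integrable M (\<lambda>\<omega>. Y i \<omega> * Y j \<omega>) \<and> expectation (\<lambda>\<omega>. Y i \<omega> * Y j \<omega>) = 0"
    if "i \<in> I" "j \<in> I" "i \<noteq> j" for i j
  proof -
    have "indep_vars (\<lambda>_. borel) Y {i, j}"
      by (rule indep_vars_subset[OF indepY]) (use that in auto)
    moreover have "integrable M (Y k)" if "k \<in> {i, j}" for k
      using that \<open>i \<in> I\<close> \<open>j \<in> I\<close> intY by auto
    ultimately show ?thesis
      using indep_vars_lebesgue_integral[of "{i, j}" Y] indep_vars_integrable[of "{i, j}" Y] that mean
      by simp
  qed
  have diag: "integrable M (\<lambda>\<omega>. Y i \<omega> * Y i \<omega>)" if "i \<in> I" for i
  proof -
    have "(\<lambda>\<omega>. Y i \<omega> * Y i \<omega>) = (\<lambda>\<omega>. (X i \<omega>)\<^sup>2 - 2 * expectation (X i) * X i \<omega> + (expectation (X i))\<^sup>2)"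
      by (simp add: Y_def power2_eq_square algebra_simps)
    then show ?thesis using int int2 that by simp
  qed
  have intYY: "integrable M (\<lambda>\<omega>. Y i \<omega> * Y j \<omega>)" if "i \<in> I" "j \<in> I" for i j
    using cross[of i j] diag[of i] that by (cases "i = j") auto
  have "(\<Sum>i\<in>I. X i \<omega>) - expectation (\<lambda>\<omega>. \<Sum>i\<in>I. X i \<omega>) = (\<Sum>i\<in>I. Y i \<omega>)" for \<omega>
    using int by (simp add: Y_def sum_subtractf)
  then have "variance (\<lambda>\<omega>. \<Sum>i\<in>I. X i \<omega>) = expectation (\<lambda>\<omega>. \<Sum>i\<in>I. \<Sum>j\<in>I. Y i \<omega> * Y j \<omega>)"
    by (simp add: power2_eq_square sum_product)
  also have "\<dots> = (\<Sum>i\<in>I. \<Sum>j\<in>I. expectation (\<lambda>\<omega>. Y i \<omega> * Y j \<omega>))"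
    using intYY by simp
  also have "\<dots> = (\<Sum>i\<in>I. \<Sum>j\<in>I. if j = i then variance (X i) else 0)"
  proof (intro sum.cong refl)
    fix i j assume "i \<in> I" "j \<in> I"
    then show "expectation (\<lambda>\<omega>. Y i \<omega> * Y j \<omega>) = (if j = i then variance (X i) else 0)"
      using cross[of i j] by (auto simp: Y_def power2_eq_square)
  qed
  also have "\<dots> = (\<Sum>i\<in>I. variance (X i))"
    using I by simp
  finally show ?thesis .
qed

text \<open>The number of hits is a sum of indicators, which inherit independence from the \<open>Z i\<close>, and a
  Bernoulli variable of parameter \<open>q\<close> has variance \<open>q (1 - q)\<close>. The factor \<open>a\<close> stands for
  the inverse volume.\<close>

lemma (in prob_space) empirical_frequency_moments:
  fixes Z :: "nat \<Rightarrow> 'a \<Rightarrow> 'b::topological_space" and a :: real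
  assumes "N > 0" and indep: "indep_vars (\<lambda>_. borel) Z {..<N}" and S: "S \<in> sets borel"
    and q: "\<And>i. i < N \<Longrightarrow> prob {\<omega>\<in>space M. Z i \<omega> \<in> S} = q"
  defines "F \<equiv> \<lambda>\<omega>. a * (real (card {i. i < N \<and> Z i \<omega> \<in> S}) / real N)"
  shows "expectation F = a * q" and "variance F = a\<^sup>2 * (q * (1 - q)) / real N"
proof -
  define X where "X i \<omega> = (indicator S (Z i \<omega>) :: real)" for i \<omega>
  have indepX: "indep_vars (\<lambda>_. borel) X {..<N}"
    unfolding X_def by (rule indep_vars_compose2[OF indep]) (use S in auto)
  have meas: "Z i \<in> measurable M borel" if "i < N" for i
    using indep that by (auto simp: indep_vars_def)
  have E: "{\<omega>\<in>space M. Z i \<omega> \<in> S} \<in> events" if "i < N" for i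
    using measurable_sets[OF meas[OF that] S] by (simp add: vimage_def Int_def conj_commute)
  have Xind: "X i \<omega> = indicator {\<omega>\<in>space M. Z i \<omega> \<in> S} \<omega>" if "\<omega> \<in> space M" for i \<omega>
    using that by (simp add: X_def indicator_def)
  have int: "integrable M (X i)" and mean: "expectation (X i) = q" if "i < N" for i
  proof -
    have "integrable M (\<lambda>\<omega>. indicator {\<omega>\<in>space M. Z i \<omega> \<in> S} \<omega> :: real)"
      using E[OF that] by (simp add: emeasure_eq_measure)
    then show "integrable M (X i)"
      by (subst Bochner_Integration.integrable_cong[OF refl Xind]) auto
    have "expectation (X i) = expectation (\<lambda>\<omega>. indicator {\<omega>\<in>space M. Z i \<omega> \<in> S} \<omega>)"
      by (rule Bochner_Integration.integral_cong[OF refl Xind])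
    also have "\<dots> = q" using q[OF that] E[OF that] by simp
    finally show "expectation (X i) = q" .
  qed
  have sq: "(X i \<omega>)\<^sup>2 = X i \<omega>" for i \<omega> by (simp add: X_def indicator_def)
  have var: "variance (X i) = q * (1 - q)" if "i < N" for i
  proof -
    have "variance (X i) = q - q\<^sup>2"
      by (subst variance_eq) (simp_all add: sq int mean that)
    then show ?thesis by (simp add: power2_eq_square right_diff_distrib)
  qed
  have card: "real (card {i. i < N \<and> Z i \<omega> \<in> S}) = (\<Sum>i<N. X i \<omega>)" for \<omega>
  proof -
    have "(\<Sum>i<N. X i \<omega>) = real (card ({..<N} \<inter> {i. Z i \<omega> \<in> S}))"
      by (simp add: X_def indicator_def sum.If_cases)
    also have "{..<N} \<inter> {i. Z i \<omega> \<in> S} = {i. i < N \<and> Z i \<omega> \<in> S}" by auto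
    finally show ?thesis by simp
  qed
  have F: "F = (\<lambda>\<omega>. (a / real N) * (\<Sum>i<N. X i \<omega>))"
    by (simp add: F_def card)
  have esum: "expectation (\<lambda>\<omega>. \<Sum>i<N. X i \<omega>) = real N * q"
    using int mean by simp
  then show E: "expectation F = a * q"
    using \<open>N > 0\<close> by (simp add: F)
  have vsum: "variance (\<lambda>\<omega>. \<Sum>i<N. X i \<omega>) = real N * (q * (1 - q))"
    using variance_sum_indep_vars[OF _ indepX] int var by (simp add: sq)
  have "(F \<omega> - expectation F)\<^sup>2 =
      (a / real N)\<^sup>2 * ((\<Sum>i<N. X i \<omega>) - expectation (\<lambda>\<omega>. \<Sum>i<N. X i \<omega>))\<^sup>2" for \<omega>
    unfolding E esum using \<open>N > 0\<close>
    by (simp add: F power_mult_distrib[symmetric] right_diff_distrib)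
  then have "variance F = (a / real N)\<^sup>2 * variance (\<lambda>\<omega>. \<Sum>i<N. X i \<omega>)"
    by simp
  also have "\<dots> = a\<^sup>2 * (q * (1 - q)) / real N"
    unfolding vsum using \<open>N > 0\<close> by (simp add: power2_eq_square)
  finally show "variance F = a\<^sup>2 * (q * (1 - q)) / real N" .
qed

section \<open>Averages and limits\<close>

text \<open>For \<open>S\<close> of finite measure this is the monotonicity of the integral. For \<open>S\<close> of infinite measure,
  \<open>measure M S = 0\<close> and the average is \<open>0\<close> by convention; then \<open>f \<ge> a - \<eta>\<close> on \<open>S\<close> and the
  finite integral \<open>q\<close> force \<open>a \<le> \<eta>\<close>, so the estimate persists.\<close>

lemma average_of_density_close:
  fixes f :: "'a \<Rightarrow> real"
  assumes S: "S \<in> sets M" "emeasure M S > 0" and a: "a \<ge> 0" and eta: "\<eta> > 0"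
    and close: "\<And>z. z \<in> S \<Longrightarrow> \<bar>f z - a\<bar> \<le> \<eta>"
    and Q: "ennreal q = (\<integral>\<^sup>+z\<in>S. ennreal (f z) \<partial>M)" "q \<ge> 0"
  shows "\<bar>1 / measure M S * q - a\<bar> \<le> \<eta>"
proof -
  have "(\<integral>\<^sup>+z\<in>S. ennreal (a - \<eta>) \<partial>M) \<le> (\<integral>\<^sup>+z\<in>S. ennreal (f z) \<partial>M)"
    using close by (intro nn_integral_mono) (force simp: indicator_def intro!: ennreal_leI)
  then have low: "ennreal (a - \<eta>) * emeasure M S \<le> ennreal q"
    unfolding Q(1) using S(1) by (simp add: nn_integral_cmult_indicator)
  have "(\<integral>\<^sup>+z\<in>S. ennreal (f z) \<partial>M) \<le> (\<integral>\<^sup>+z\<in>S. ennreal (a + \<eta>) \<partial>M)"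
    using close by (intro nn_integral_mono) (force simp: indicator_def intro!: ennreal_leI)
  then have up: "ennreal q \<le> ennreal (a + \<eta>) * emeasure M S"
    unfolding Q(1) using S(1) by (simp add: nn_integral_cmult_indicator)
  show ?thesis
  proof (cases "emeasure M S = \<infinity>")
    case True
    have "a \<le> \<eta>"
    proof (rule ccontr)
      assume "\<not> a \<le> \<eta>"
      then have "ennreal (a - \<eta>) * emeasure M S = \<infinity>"
        using True by (simp add: ennreal_mult_top)
      then show False using low by (simp add: top_unique)
    qed
    then show ?thesis using True a by (simp add: measure_def)
  next
    case False
    then have em: "emeasure M S = ennreal (measure M S)"
      by (simp add: emeasure_eq_ennreal_measure)
    then have pos: "measure M S > 0" using S(2) by (metis ennreal_0 less_irrefl zero_less_measure_iff)
    have "ennreal q \<le> ennreal ((a + \<eta>) * measure M S)"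
      using up by (simp only: em ennreal_mult''[OF measure_nonneg])
    then have "q \<le> (a + \<eta>) * measure M S"
      using pos a eta by (simp add: ennreal_le_iff)
    moreover have "(a - \<eta>) * measure M S \<le> q"
    proof (cases "a - \<eta> \<ge> 0")
      case True
      then show ?thesis using low pos Q(2) by (simp add: em ennreal_mult[symmetric])
    next
      case False
      then have "(a - \<eta>) * measure M S \<le> 0" using pos by (intro mult_nonpos_nonneg) auto
      then show ?thesis using Q(2) by simp
    qed
    ultimately show ?thesis using pos by (simp add: abs_le_iff field_simps)
  qed
qed

lemma tendsto_0_if_le_affine:
  fixes w r :: "nat \<Rightarrow> real"
  assumes r: "r \<longlonglongrightarrow> 0" and w: "\<And>n. w n \<ge> 0"
    and le: "\<And>\<eta>. \<eta> > 0 \<Longrightarrow> \<exists>C. \<forall>n. w n \<le> C * r n + \<eta>"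
  shows "w \<longlonglongrightarrow> 0"
proof (rule tendstoI)
  fix e :: real assume "e > 0"
  then obtain C where C: "\<And>n. w n \<le> C * r n + e / 2" using le[of "e / 2"] by auto
  have "(\<lambda>n. C * r n + e / 2) \<longlonglongrightarrow> C * 0 + e / 2" by (intro tendsto_intros r)
  then have "eventually (\<lambda>n. C * r n + e / 2 < e) sequentially"
    by (rule order_tendstoD) (use \<open>e > 0\<close> in simp)
  then show "eventually (\<lambda>n. dist (w n) 0 < e) sequentially"
    by eventually_elim (use C w in \<open>force simp: dist_real_def intro: le_less_trans\<close>)
qed

section \<open>The estimator of the heat kernel\<close>

theorem theorem3p1:
  fixes A :: "('a::{t2_space, second_countable_topology}, 'm::finite) chart set"
    and g :: "('a, 'm) metric_tensor"
    and vol :: "'a measure"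
    and p :: "real \<Rightarrow> 'a \<Rightarrow> 'a \<Rightarrow> real"
    and x y :: 'a
    and t :: real
    and P :: "nat \<Rightarrow> 'w measure"
    and B :: "nat \<Rightarrow> nat \<Rightarrow> real \<Rightarrow> 'w \<Rightarrow> 'a"
  assumes "complete_riemannian_manifold A g"
    and "riemannian_volume A g vol"
    and "heat_kernel A g vol p"
    and "t > 0"
    and "\<And>y1 y2. geodesic_dist A g x y1 = geodesic_dist A g x y2 \<Longrightarrow> p t x y1 = p t x y2"
    and "geodesic_dist A g x y > 0"
    and "\<And>N. N > 0 \<Longrightarrow> independent_brownian_motions vol p x (P N) N (B N)"
  shows "(\<forall>N>0. ((\<lambda>\<epsilon>. prob_space.expectation (P N)
              (heat_kernel_estimator A g vol (B N) t x y \<epsilon> N))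
            \<longlongrightarrow> p t x y) (at_right 0)) \<and>
         (\<forall>(\<epsilon> :: nat \<Rightarrow> real) (N :: nat \<Rightarrow> nat).
            (\<forall>n. \<epsilon> n > 0 \<and> N n > 0) \<longrightarrow>
            (\<lambda>n. 1 / (real (N n) * \<epsilon> n ^ CARD('m))) \<longlonglongrightarrow> 0 \<longrightarrow>
            (\<lambda>n. prob_space.variance (P (N n))
              (heat_kernel_estimator A g vol (B (N n)) t x y (\<epsilon> n) (N n))) \<longlonglongrightarrow> 0)"
proof -
  note complete = assms(1) and vol = assms(2) and heat = assms(3) and t = assms(4)
    and radial = assms(5) and indep = assms(7)
  have atlas: "smooth_atlas A" and metric: "riemannian_metric A g"
    and con: "connected (UNIV :: 'a set)"
    using complete by (auto simp: complete_riemannian_manifold_def)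
  interpret riemannian_atlas A g using atlas metric by unfold_locales
  define d where "d = geodesic_dist A g x"
  define S where "S \<epsilon> = shell A g x (d y) \<epsilon>" for \<epsilon>
  define v where "v \<epsilon> = measure vol (S \<epsilon>)" for \<epsilon>
  \<comment> \<open>the hitting probability depends neither on \<open>N\<close> nor on the path (\<open>q_eq_N\<close> below), so it
    can be read off the case \<open>N = 1\<close>\<close>
  define q where "q \<epsilon> = measure (P 1) {\<omega>\<in>space (P 1). B 1 0 t \<omega> \<in> S \<epsilon>}" for \<epsilon>
  have Sdef: "z \<in> S \<epsilon> \<longleftrightarrow> \<bar>d z - d y\<bar> < \<epsilon>" for z \<epsilon>
    by (simp add: S_def shell_def d_def)
  have sets_vol: "sets vol = sets borel" using vol by (simp add: riemannian_volume_def)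
  have S_borel: "S \<epsilon> \<in> sets borel" for \<epsilon>
    using open_shell[OF con] by (simp add: S_def)
  have S_mono: "S \<epsilon> \<subseteq> S \<epsilon>'" if "\<epsilon> \<le> \<epsilon>'" for \<epsilon> \<epsilon>'
    using that Sdef by force
  have bm: "brownian_motion vol p x (P N) (B N i)" if "i < N" for N i
    using indep[of N] that by (auto simp: independent_brownian_motions_def)
  have prob: "prob_space (P N)" if "N > 0" for N
    using bm[OF that] by (simp add: brownian_motion_def)
  interpret P1: prob_space "P 1" by (rule prob) simp
  have p_nonneg: "p t x z \<ge> 0" for z
    using bm[of 0 1] t by (simp add: brownian_motion_def)
  \<comment> \<open>the one-time marginal, from the finite-dimensional distributions of length one\<close>
  have hit: "emeasure (P N) {\<omega>\<in>space (P N). B N i t \<omega> \<in> S \<epsilon>} =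
      (\<integral>\<^sup>+z\<in>S \<epsilon>. ennreal (p t x z) \<partial>vol)" if "i < N" for N i \<epsilon>
  proof -
    have "sorted_wrt (<) (0 # map fst [(t, S \<epsilon>)]) \<and> snd ` set [(t, S \<epsilon>)] \<subseteq> sets borel"
      using t S_borel by simp
    then have "emeasure (P N) {\<omega>\<in>space (P N). \<forall>(s, D)\<in>set [(t, S \<epsilon>)]. B N i s \<omega> \<in> D} =
        markov_fdd vol p x 0 [(t, S \<epsilon>)]"
      using bm[OF that] unfolding brownian_motion_def by blast
    then show ?thesis by simp
  qed
  have q_eq: "ennreal (q \<epsilon>) = (\<integral>\<^sup>+z\<in>S \<epsilon>. ennreal (p t x z) \<partial>vol)" for \<epsilon>
    using hit[OF zero_less_one] by (simp only: q_def P1.emeasure_eq_measure)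
  have q_eq_N: "measure (P N) {\<omega>\<in>space (P N). B N i t \<omega> \<in> S \<epsilon>} = q \<epsilon>" if "i < N" for N i \<epsilon>
    using hit[OF that] hit[of 0 1 \<epsilon>] by (simp add: measure_def q_def)
  have q01: "0 \<le> q \<epsilon>" "q \<epsilon> \<le> 1" for \<epsilon> unfolding q_def by (rule measure_nonneg P1.prob_le_1)+

  have moments: "prob_space.expectation (P N) (heat_kernel_estimator A g vol (B N) t x y \<epsilon> N) =
        1 / v \<epsilon> * q \<epsilon>"
    "prob_space.variance (P N) (heat_kernel_estimator A g vol (B N) t x y \<epsilon> N) =
        (1 / v \<epsilon>)\<^sup>2 * (q \<epsilon> * (1 - q \<epsilon>)) / real N" if "N > 0" for N \<epsilon>
  proof -
    interpret PN: prob_space "P N" using prob[OF that] .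
    have "PN.indep_vars (\<lambda>_. Pi\<^sub>M {0..} (\<lambda>_. borel)) (\<lambda>i \<omega>. \<lambda>s\<in>{0..}. B N i s \<omega>) {..<N}"
      using indep[OF that] by (simp add: independent_brownian_motions_def)
    then have "PN.indep_vars (\<lambda>_. borel) (\<lambda>i \<omega>. (\<lambda>s\<in>{0..}. B N i s \<omega>) t) {..<N}"
      by (rule PN.indep_vars_compose2) (use t in \<open>auto intro!: measurable_component_singleton\<close>)
    then have "PN.indep_vars (\<lambda>_. borel) (\<lambda>i. B N i t) {..<N}"
      using t by simp
    note * = PN.empirical_frequency_moments[OF that this S_borel q_eq_N, where a="1 / v \<epsilon>"]
    have "heat_kernel_estimator A g vol (B N) t x y \<epsilon> N =
        (\<lambda>\<omega>. 1 / v \<epsilon> * (real (card {i. i < N \<and> B N i t \<omega> \<in> S \<epsilon>}) / real N))"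
      by (simp add: fun_eq_iff heat_kernel_estimator_def Let_def v_def S_def d_def)
    with * show "prob_space.expectation (P N) (heat_kernel_estimator A g vol (B N) t x y \<epsilon> N) =
        1 / v \<epsilon> * q \<epsilon>"
      "prob_space.variance (P N) (heat_kernel_estimator A g vol (B N) t x y \<epsilon> N) =
        (1 / v \<epsilon>)\<^sup>2 * (q \<epsilon> * (1 - q \<epsilon>)) / real N"
      by simp_all
  qed

  obtain \<epsilon>0 c0 where \<epsilon>0: "\<epsilon>0 > 0" "c0 > 0"
    "\<And>\<epsilon>. 0 < \<epsilon> \<Longrightarrow> \<epsilon> \<le> \<epsilon>0 \<Longrightarrow> ennreal (c0 * \<epsilon> ^ CARD('m)) \<le> emeasure vol (S \<epsilon>)"
    using shell_volume_lower_bound[OF con vol, of x y] unfolding S_def d_def by blast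
  have near: "\<exists>\<delta>. 0 < \<delta> \<and> \<delta> \<le> \<epsilon>0 \<and> (\<forall>\<epsilon>. 0 < \<epsilon> \<and> \<epsilon> \<le> \<delta> \<longrightarrow> \<bar>1 / v \<epsilon> * q \<epsilon> - p t x y\<bar> \<le> \<eta>)"
    if "\<eta> > 0" for \<eta>
  proof -
    obtain \<delta> where \<delta>: "\<delta> > 0" "\<And>z. \<bar>d z - d y\<bar> < \<delta> \<Longrightarrow> \<bar>p t x z - p t x y\<bar> < \<eta>"
    proof (rule uniform_closeness_near_level_set[where d=d and f="p t x" and y=y and \<eta>=\<eta>])
      show "continuous_on UNIV d" unfolding d_def by (rule continuous_geodesic_dist[OF con])
      show "continuous_on UNIV (p t x)" by (rule heat_kernel_continuous[OF heat t])
      show "p t x z = p t x w" if "d z = d w" for z w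
        using that unfolding d_def by (rule radial)
      show "\<exists>K. compact K \<and> connected K \<and> y \<in> K \<and> z \<in> K" for z
        by (rule compact_connected_joining[OF con])
    qed (use \<open>\<eta> > 0\<close> in auto)
    have "\<bar>1 / v \<epsilon> * q \<epsilon> - p t x y\<bar> \<le> \<eta>" if \<epsilon>: "0 < \<epsilon>" "\<epsilon> \<le> min \<delta> \<epsilon>0" for \<epsilon>
      unfolding v_def
    proof (rule average_of_density_close[where f="p t x"])
      have "0 < ennreal (c0 * \<epsilon> ^ CARD('m))" using \<epsilon> \<epsilon>0 by simp
      also have "\<dots> \<le> emeasure vol (S \<epsilon>)" using \<epsilon> by (intro \<epsilon>0) auto
      finally show "0 < emeasure vol (S \<epsilon>)" .
      show "\<bar>p t x z - p t x y\<bar> \<le> \<eta>" if "z \<in> S \<epsilon>" for z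
        using that \<delta>(2)[of z] \<epsilon> by (simp add: Sdef)
    qed (use S_borel sets_vol p_nonneg \<open>\<eta> > 0\<close> q_eq q01 in auto)
    then show ?thesis using \<delta>(1) \<epsilon>0(1) by (intro exI[of _ "min \<delta> \<epsilon>0"]) auto
  qed

  have unbiased: "((\<lambda>\<epsilon>. 1 / v \<epsilon> * q \<epsilon>) \<longlongrightarrow> p t x y) (at_right 0)"
  proof (rule tendstoI)
    fix e :: real assume "e > 0"
    then obtain \<delta> where \<delta>: "\<delta> > 0" "\<And>\<epsilon>. 0 < \<epsilon> \<Longrightarrow> \<epsilon> \<le> \<delta> \<Longrightarrow> \<bar>1 / v \<epsilon> * q \<epsilon> - p t x y\<bar> \<le> e / 2"
      using near[of "e / 2"] by auto
    have "dist (1 / v \<epsilon> * q \<epsilon>) (p t x y) < e" if "0 < \<epsilon>" "\<epsilon> < \<delta>" for \<epsilon>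
      using \<delta>(2)[of \<epsilon>] that \<open>e > 0\<close> by (simp add: dist_real_def)
    then show "eventually (\<lambda>\<epsilon>. dist (1 / v \<epsilon> * q \<epsilon>) (p t x y) < e) (at_right 0)"
      using \<delta>(1) by (auto simp: eventually_at_right_field)
  qed

  \<comment> \<open>the shells increase to the whole manifold\<close>
  have far: "\<exists>R>0. \<forall>\<epsilon>\<ge>R. 1 - q \<epsilon> \<le> \<kappa>" if "\<kappa> > 0" for \<kappa>
  proof -
    define E where "E n = {\<omega>\<in>space (P 1). B 1 0 t \<omega> \<in> S (real n)}" for n
    have meas: "B 1 0 t \<in> measurable (P 1) borel"
      using bm[of 0 1] t by (simp add: brownian_motion_def)
    have E_event: "{\<omega>\<in>space (P 1). B 1 0 t \<omega> \<in> S \<epsilon>} \<in> sets (P 1)" for \<epsilon>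
      using measurable_sets[OF meas S_borel] by (simp add: vimage_def Int_def conj_commute)
    have "(\<lambda>n. P1.prob (E n)) \<longlonglongrightarrow> P1.prob (\<Union>n. E n)"
    proof (rule P1.finite_Lim_measure_incseq)
      show "range E \<subseteq> P1.events" using E_event by (auto simp: E_def)
      show "incseq E"
        unfolding incseq_def E_def using S_mono[OF of_nat_mono] by blast
    qed
    also have "(\<Union>n. E n) = space (P 1)"
    proof -
      have "\<exists>n. z \<in> S (real n)" for z using reals_Archimedean2[of "\<bar>d z - d y\<bar>"] by (simp add: Sdef)
      then show ?thesis by (auto simp: E_def)
    qed
    finally have lim: "(\<lambda>n. q (real n)) \<longlonglongrightarrow> 1"
      by (simp only: P1.prob_space E_def q_def)
    have "eventually (\<lambda>n. 1 - \<kappa> < q (real n)) sequentially"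
      using order_tendstoD(1)[OF lim, of "1 - \<kappa>"] that by simp
    then obtain n0 where n0: "\<And>n. n \<ge> n0 \<Longrightarrow> 1 - \<kappa> < q (real n)"
      by (auto simp: eventually_sequentially)
    have "1 - q \<epsilon> \<le> \<kappa>" if "\<epsilon> \<ge> real (Suc n0)" for \<epsilon>
    proof -
      have "q (real (Suc n0)) \<le> q \<epsilon>"
        unfolding q_def using S_mono[OF that] E_event by (intro P1.finite_measure_mono) auto
      then show ?thesis using n0[of "Suc n0"] by simp
    qed
    then show ?thesis by (intro exI[of _ "real (Suc n0)"]) auto
  qed

  define W where "W \<epsilon> N = (1 / v \<epsilon>)\<^sup>2 * (q \<epsilon> * (1 - q \<epsilon>)) / real N" for \<epsilon> N
  have W_nonneg: "W \<epsilon> N \<ge> 0" for \<epsilon> N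
    using q01[of \<epsilon>] by (simp add: W_def)
  have W_bound: "\<exists>C. \<forall>\<epsilon>>0. \<forall>N>0. W \<epsilon> N \<le> C * (1 / (real N * \<epsilon> ^ CARD('m))) + \<eta>"
    if "\<eta> > 0" for \<eta>
  proof -
    let ?m = "CARD('m)"
    obtain \<delta> where \<delta>: "0 < \<delta>" "\<delta> \<le> \<epsilon>0"
      "\<And>\<epsilon>. 0 < \<epsilon> \<Longrightarrow> \<epsilon> \<le> \<delta> \<Longrightarrow> \<bar>1 / v \<epsilon> * q \<epsilon> - p t x y\<bar> \<le> 1"
      using near[of 1] by auto
    define v0 where "v0 = c0 * \<delta> ^ ?m"
    have "v0 > 0" using \<delta> \<epsilon>0 by (simp add: v0_def)
    obtain R where R: "R > 0" "\<And>\<epsilon>. \<epsilon> \<ge> R \<Longrightarrow> 1 - q \<epsilon> \<le> \<eta> * v0\<^sup>2"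
      using far[of "\<eta> * v0\<^sup>2"] \<open>v0 > 0\<close> \<open>\<eta> > 0\<close> by auto
    \<comment> \<open>\<open>v \<epsilon> = 0\<close> means infinite volume here, where the variance vanishes; hence the hypothesis \<open>v \<epsilon> > 0\<close>\<close>
    have v_ge: "v \<epsilon> \<ge> a" if "ennreal a \<le> emeasure vol (S \<epsilon>)" "v \<epsilon> > 0" for a \<epsilon>
    proof -
      have "emeasure vol (S \<epsilon>) \<noteq> \<infinity>" using that(2) by (auto simp: v_def measure_def)
      then have "emeasure vol (S \<epsilon>) = ennreal (v \<epsilon>)"
        unfolding v_def by (simp add: emeasure_eq_ennreal_measure)
      then show ?thesis using that by (simp add: ennreal_le_iff)
    qed
    define C1 where "C1 = (p t x y + 1) / c0"
    define C2 where "C2 = R ^ ?m / v0\<^sup>2"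
    have C: "C1 \<ge> 0" "C2 \<ge> 0"
      using p_nonneg[of y] \<epsilon>0 R(1) by (simp_all add: C1_def C2_def)
    have "W \<epsilon> N \<le> (C1 + C2) * (1 / (real N * \<epsilon> ^ ?m)) + \<eta>" if \<epsilon>: "\<epsilon> > 0" and N: "N > 0" for \<epsilon> N
    proof (cases "v \<epsilon> > 0")
      case False
      then have "v \<epsilon> = 0" by (simp add: v_def zero_less_measure_iff)
      then show ?thesis using C \<epsilon> \<open>\<eta> > 0\<close> by (simp add: W_def)
    next
      case True
      let ?r = "1 / (real N * \<epsilon> ^ ?m)"
      have r: "?r > 0" using \<epsilon> N by simp
      have "C1 * ?r \<ge> 0" "C2 * ?r \<ge> 0" using C r by (intro mult_nonneg_nonneg; simp)+
      then have split: "C1 * ?r \<le> (C1 + C2) * ?r + \<eta>" "C2 * ?r \<le> (C1 + C2) * ?r + \<eta>"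
        "\<eta> \<le> (C1 + C2) * ?r + \<eta>"
        unfolding distrib_right using \<open>\<eta> > 0\<close> by linarith+
      have inv_v: "(1 / v \<epsilon>)\<^sup>2 \<le> (1 / v0)\<^sup>2" if "\<delta> < \<epsilon>"
      proof -
        have "emeasure vol (S \<delta>) \<le> emeasure vol (S \<epsilon>)"
          using S_mono[of \<delta> \<epsilon>] that S_borel sets_vol by (intro emeasure_mono) auto
        with \<epsilon>0(3)[of \<delta>] \<delta> have "v0 \<le> v \<epsilon>"
          using True unfolding v0_def by (intro v_ge) (auto intro: order_trans)
        then show ?thesis
          using \<open>v0 > 0\<close> by (intro power_mono divide_left_mono mult_pos_pos) auto
      qed
      consider "\<epsilon> \<le> \<delta>" | "\<delta> < \<epsilon>" "\<epsilon> < R" | "\<delta> < \<epsilon>" "R \<le> \<epsilon>" by linarith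
      then show ?thesis
      proof cases
        case 1
        have v1: "v \<epsilon> \<ge> c0 * \<epsilon> ^ ?m" using \<epsilon>0(3)[of \<epsilon>] \<epsilon> 1 \<delta>(2) True by (intro v_ge) auto
        have ce: "c0 * \<epsilon> ^ ?m > 0" using \<epsilon> \<epsilon>0 by simp
        have "W \<epsilon> N = (1 / v \<epsilon> * q \<epsilon>) * (1 - q \<epsilon>) * (1 / (v \<epsilon> * real N))"
          by (simp add: W_def power2_eq_square)
        also have "\<dots> \<le> (p t x y + 1) * 1 * (1 / (c0 * \<epsilon> ^ ?m * real N))"
        proof (intro mult_mono)
          show "1 / v \<epsilon> * q \<epsilon> \<le> p t x y + 1" using \<delta>(3)[OF \<epsilon> 1] by linarith
          show "1 / (v \<epsilon> * real N) \<le> 1 / (c0 * \<epsilon> ^ ?m * real N)"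
            using v1 ce N by (intro frac_le mult_right_mono mult_pos_pos[OF ce]) auto
        qed (use q01[of \<epsilon>] True p_nonneg[of y] in auto)
        also have "\<dots> = C1 * ?r" by (simp add: C1_def mult.commute mult.left_commute)
        also note split(1)
        finally show ?thesis .
      next
        case 2
        note inv_v[OF 2(1)]
        moreover have "q \<epsilon> * (1 - q \<epsilon>) \<le> 1 * 1" using q01[of \<epsilon>] by (intro mult_mono) auto
        ultimately have "W \<epsilon> N \<le> (1 / v0)\<^sup>2 * (1 * 1) / real N"
          unfolding W_def using q01[of \<epsilon>] by (intro divide_right_mono mult_mono) auto
        \<comment> \<open>as \<open>\<epsilon>\<close> is bounded, \<open>1/N\<close> is controlled by \<open>1/(N \<epsilon>\<^sup>m)\<close>\<close>
        also have "\<dots> = (1 / v0)\<^sup>2 * \<epsilon> ^ ?m * ?r" using \<epsilon> by simp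
        also have "\<dots> \<le> (1 / v0)\<^sup>2 * R ^ ?m * ?r"
          using 2 \<epsilon> r by (intro mult_right_mono mult_left_mono power_mono) auto
        also have "\<dots> = C2 * ?r" by (simp add: C2_def power_divide)
        also note split(2)
        finally show ?thesis .
      next
        case 3
        note inv_v[OF 3(1)]
        moreover have "q \<epsilon> * (1 - q \<epsilon>) \<le> 1 * (\<eta> * v0\<^sup>2)"
          using q01[of \<epsilon>] R(2)[OF 3(2)] by (intro mult_mono) auto
        ultimately have "(1 / v \<epsilon>)\<^sup>2 * (q \<epsilon> * (1 - q \<epsilon>)) \<le> (1 / v0)\<^sup>2 * (1 * (\<eta> * v0\<^sup>2))"
          by (rule mult_mono) (use q01[of \<epsilon>] in auto)
        also have "\<dots> = \<eta>" using \<open>v0 > 0\<close> by (simp add: power_divide)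
        finally have "W \<epsilon> N \<le> \<eta> / real N" unfolding W_def by (intro divide_right_mono) auto
        also have "\<dots> \<le> \<eta>" using N \<open>\<eta> > 0\<close> by (simp add: divide_le_eq)
        also note split(3)
        finally show ?thesis .
      qed
    qed
    then show ?thesis by blast
  qed

  show ?thesis
  proof (intro conjI allI impI)
    fix N :: nat assume "N > 0"
    then show "((\<lambda>\<epsilon>. prob_space.expectation (P N) (heat_kernel_estimator A g vol (B N) t x y \<epsilon> N))
        \<longlongrightarrow> p t x y) (at_right 0)"
      using unbiased by (simp add: moments(1))
  next
    fix \<epsilon> :: "nat \<Rightarrow> real" and N :: "nat \<Rightarrow> nat"
    assume pos: "\<forall>n. \<epsilon> n > 0 \<and> N n > 0"
      and lim: "(\<lambda>n. 1 / (real (N n) * \<epsilon> n ^ CARD('m))) \<longlonglongrightarrow> 0"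
    have "(\<lambda>n. W (\<epsilon> n) (N n)) \<longlonglongrightarrow> 0"
    proof (rule tendsto_0_if_le_affine[OF lim W_nonneg])
      fix \<eta> :: real assume "\<eta> > 0"
      from W_bound[OF this] pos
      show "\<exists>C. \<forall>n. W (\<epsilon> n) (N n) \<le> C * (1 / (real (N n) * \<epsilon> n ^ CARD('m))) + \<eta>" by meson
    qed
    then show "(\<lambda>n. prob_space.variance (P (N n))
        (heat_kernel_estimator A g vol (B (N n)) t x y (\<epsilon> n) (N n))) \<longlonglongrightarrow> 0"
      using pos by (simp add: moments(2) W_def)
  qed
qed

end
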